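(* Let $\mathbb I_n$ be the set of idempotent ideals ($I^2=I$) of $\mathbb{S}_n$. (1) The map $\mathcal C_n\to\mathbb I_n$, $C\mapsto I_C:=\sum_{f\in C}I_f$ (with $I_\emptyset=0$), is a bijection. (2) $\mathbb I_n$ is finite. Its cardinality is the Dedekind number $\mathfrak d_n$, i.e. the number of antichains (families of pairwise incomparable subsets, including the empty family) in the power set of $\{1,\dots,n\}$ ordered by inclusion. (3) $\eta(I)=I$ for every idempotent ideal $I$ of $\mathbb{S}_n$.
   Context: $K$ is a field. $\mathbb{S}_n$ is the $K$-algebra generated by $x_1,\dots,x_n,y_1,\dots,y_n$ subject to the defining relations $y_ix_i=1$ for all $i$, and $[x_i,y_j]=[x_i,x_j]=[y_i,y_j]=0$ for all $i\ne j$. For each $i$, $\mathbb{S}_1(i)$ is the subalgebra generated by $x_i,y_i$, and $\mathbb{S}_n=\mathbb{S}_1(1)\otimes\cdots\otimes\mathbb{S}_1(n)$. $F(i)=\bigoplus_{k,l\in\mathbb N}K(x_i^ky_i^l-x_i^{k+1}y_i^{l+1})$ is an ideal of $\mathbb{S}_1(i)$. $\mathcal B_n$ is the set of functions $f:\{1,\dots,n\}\to\{0,1\}$, partially ordered by $f\ge g$ iff $f(i)\ge g(i)$ for all $i$. For $f\in\mathcal B_n$, set $I_f=I_{f(1)}(1)\otimes\cdots\otimes I_{f(n)}(n)$, where $I_0(i)=F(i)$ and $I_1(i)=\mathbb{S}_1(i)$. $\mathcal C_n$ is the set of subsets $C\subseteq\mathcal B_n$ whose distinct elements are pairwise incomparable.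 $\eta$ is the involution of $\mathbb{S}_n$, i.e. the $K$-algebra anti-automorphism with $\eta(x_i)=y_i$ and $\eta(y_i)=x_i$. *)

theory Defs
  imports Main
begin

text \<open>The Jacobson algebra S_n over a field K is realised as the monoid algebra of the
n-fold direct product of the bicyclic monoid <x,y | yx = 1>.  The K-basis of S_1 is
x^i y^j, encoded by the pair (i,j); a basis monomial of S_n is a function from the
(finite) index type 'n to such pairs.  Elements are finitely supported coefficient
functions.\<close>

type_synonym 'n mon = "'n \<Rightarrow> nat \<times> nat"

text \<open>x^i y^j * x^k y^l = x^(i+k-min j k) y^(j+l-min j k)\<close>
definition bmul :: "nat \<times> nat \<Rightarrow> nat \<times> nat \<Rightarrow> nat \<times> nat" where
  "bmul p q = (fst p + fst q - min (snd p) (fst q), snd p + snd q - min (snd p) (fst q))"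

definition mmul :: "'n mon \<Rightarrow> 'n mon \<Rightarrow> 'n mon" where
  "mmul p q = (\<lambda>t. bmul (p t) (q t))"

definition fin_supp :: "('b \<Rightarrow> 'k::zero) \<Rightarrow> bool" where
  "fin_supp a \<longleftrightarrow> finite {m. a m \<noteq> 0}"

definition Jac :: "('n mon \<Rightarrow> 'k::field) set" where
  "Jac = {a. fin_supp a}"

definition jmul :: "('n mon \<Rightarrow> 'k::field) \<Rightarrow> ('n mon \<Rightarrow> 'k) \<Rightarrow> ('n mon \<Rightarrow> 'k)" where
  "jmul a b = (\<lambda>m. \<Sum>(p, q) \<in> {(p, q). a p \<noteq> 0 \<and> b q \<noteq> 0 \<and> mmul p q = m}. a p * b q)"

definition jideal :: "('n mon \<Rightarrow> 'k::field) set \<Rightarrow> bool" where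
  "jideal I \<longleftrightarrow> I \<subseteq> Jac \<and> (\<lambda>_. 0) \<in> I
     \<and> (\<forall>a\<in>I. \<forall>b\<in>I. (\<lambda>m. a m + b m) \<in> I)
     \<and> (\<forall>a\<in>Jac. \<forall>b\<in>I. jmul a b \<in> I \<and> jmul b a \<in> I)"

definition jideal_gen :: "('n mon \<Rightarrow> 'k::field) set \<Rightarrow> ('n mon \<Rightarrow> 'k) set" where
  "jideal_gen X = \<Inter> {L. jideal L \<and> X \<subseteq> L}"

definition jideal_prod :: "('n mon \<Rightarrow> 'k::field) set \<Rightarrow> ('n mon \<Rightarrow> 'k) set \<Rightarrow> ('n mon \<Rightarrow> 'k) set" where
  "jideal_prod I J = jideal_gen {jmul a b | a b. a \<in> I \<and> b \<in> J}"

definition idempotent_ideals :: "('n mon \<Rightarrow> 'k::field) set set" where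
  "idempotent_ideals = {I. jideal I \<and> jideal_prod I I = I}"

definition ksubspace :: "('b \<Rightarrow> 'k::field) set \<Rightarrow> bool" where
  "ksubspace V \<longleftrightarrow> (\<lambda>_. 0) \<in> V \<and> (\<forall>a\<in>V. \<forall>b\<in>V. (\<lambda>m. a m + b m) \<in> V)
     \<and> (\<forall>c. \<forall>a\<in>V. (\<lambda>m. c * a m) \<in> V)"

definition kspan :: "('b \<Rightarrow> 'k::field) set \<Rightarrow> ('b \<Rightarrow> 'k) set" where
  "kspan X = \<Inter> {V. ksubspace V \<and> X \<subseteq> V}"

definition S1 :: "(nat \<times> nat \<Rightarrow> 'k::field) set" where
  "S1 = {a. fin_supp a}"

definition mono1 :: "nat \<times> nat \<Rightarrow> nat \<times> nat \<Rightarrow> 'k::field" where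
  "mono1 p = (\<lambda>q. if q = p then 1 else 0)"

definition F1 :: "(nat \<times> nat \<Rightarrow> 'k::field) set" where
  "F1 = kspan {(\<lambda>q. mono1 (k, l) q - mono1 (k + 1, l + 1) q) | k l. True}"

definition Ifac :: "bool \<Rightarrow> (nat \<times> nat \<Rightarrow> 'k::field) set" where
  "Ifac b = (if b then S1 else F1)"

text \<open>Elementary tensor a_1 \<otimes> ... \<otimes> a_n in S_n = S_1(1) \<otimes> ... \<otimes> S_1(n).\<close>
definition tensor :: "('n::finite \<Rightarrow> (nat \<times> nat \<Rightarrow> 'k::field)) \<Rightarrow> ('n mon \<Rightarrow> 'k)" where
  "tensor a = (\<lambda>m. \<Prod>t\<in>UNIV. a t (m t))"

definition Ifun :: "('n::finite \<Rightarrow> bool) \<Rightarrow> ('n mon \<Rightarrow> 'k::field) set" where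
  "Ifun f = kspan {tensor a | a. \<forall>t. a t \<in> Ifac (f t)}"

text \<open>I_C = sum of I_f, f in C (ideal generated by the union; I_{} = 0).\<close>
definition IC :: "('n::finite \<Rightarrow> bool) set \<Rightarrow> ('n mon \<Rightarrow> 'k::field) set" where
  "IC C = jideal_gen (\<Union>f\<in>C. Ifun f)"

definition antichains_B :: "('n::finite \<Rightarrow> bool) set set" where
  "antichains_B = {C. \<forall>f\<in>C. \<forall>g\<in>C. f \<le> g \<longrightarrow> f = g}"

definition dedekind :: "nat \<Rightarrow> nat" where
  "dedekind n = card {A. A \<subseteq> Pow {1..n} \<and> (\<forall>X\<in>A. \<forall>Y\<in>A. X \<subseteq> Y \<longrightarrow> X = Y)}"

text \<open>The involution eta: x^k y^l \<mapsto> x^l y^k componentwise, extended linearly.\<close>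
definition eta :: "('n mon \<Rightarrow> 'k::field) \<Rightarrow> ('n mon \<Rightarrow> 'k)" where
  "eta a = (\<lambda>m. a (\<lambda>t. prod.swap (m t)))"

end

theory Submission
  imports Defs "HOL-Library.Poly_Mapping" "HOL-Library.FuncSet" Complex_Main
begin

text \<open>The algebra is identified with the monoid algebra \<open>jac\<close> of a power of the bicyclic monoid. There
  \<open>I\<^sub>f\<close> becomes the ideal \<open>tors Z\<close>, \<open>Z = f\<^sup>-\<^sup>1(0)\<close>, of all elements annihilated from the right by a power of
  \<open>x\<^sub>i\<close> for every \<open>i \<in> Z\<close>; it is generated by the idempotent \<open>e = \<Prod>i\<in>Z. (1 - x\<^sub>i y\<^sub>i)\<close>.

  Let \<open>I\<close> be an idempotent ideal and \<open>W\<close> the complement of \<open>Z\<close>. The polynomials \<open>p\<close> in the \<open>x\<^sub>i\<close>,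
  \<open>i \<in> W\<close>, with \<open>e p \<in> I\<close> form an ideal \<open>J\<close> that becomes idempotent in the Laurent polynomial
  ring. That ring is a Noetherian domain, so \<open>J\<close> is zero or contains a monomial. In the latter case
  \<open>e \<in> I\<close>, that is \<open>tors Z \<subseteq> I\<close>. In the former case every element of \<open>I \<inter> tors Z\<close> is annihilated by
  a power of \<open>\<Prod>i\<in>W. x\<^sub>i\<close> and is therefore a sum of elements of \<open>I \<inter> tors (insert j Z)\<close>, \<open>j \<in> W\<close>. Induction on
  \<open>W\<close> shows that \<open>I\<close> is the sum of the ideals \<open>tors Z\<close> it contains.\<close>

section \<open>Noetherian monoid algebras\<close>

text \<open>Only the \<open>x_i\<close> enter the polynomials because \<open>y_i x_i = 1\<close>: a
  high power of the \<open>x_i\<close> on the right absorbs every \<open>y_i\<close>, so each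
  sandwich \<open>e a e\<close> turns into \<open>e\<close> times a polynomial. The price is that
  statements about \<open>J\<close> hold only up to a power of the \<open>x_i\<close>. The Laurent
  ring accounts for this but is never built; instead Nakayama's argument carries the powers along.
  The obstacle is that \<open>I = I^2\<close> says nothing directly about \<open>e I e\<close>,
  since a product \<open>c d\<close> has no \<open>e\<close> in its middle. It is inserted by means
  of local units: \<open>e c = e c u\<close> for some \<open>u\<close> in \<open>tors Z\<close>, and
  \<open>tors Z\<close> is generated by \<open>e\<close> as a two-sided ideal. The same device, a
  set of all \<open>w\<close> with some property that is shown to be an ideal containing
  \<open>e\<close>, is used whenever a statement about \<open>e\<close> has to reach all of
  \<open>tors Z\<close>. The set \<open>W\<close> of variables changes during the induction, so all
  polynomial rings live in one type with exponents in \<open>nat \<Rightarrow>\<^sub>0 nat\<close>,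
  and each is singled out by its set of admissible exponents.\<close>

abbreviation "keys \<equiv> Poly_Mapping.keys"
abbreviation "lookup \<equiv> Poly_Mapping.lookup"

text \<open>For products of two elements of an ideal this is the square of the ideal: sums suffice,
  because coefficients are absorbed into a factor.\<close>

inductive_set add_span :: "'a::comm_monoid_add set \<Rightarrow> 'a set" for S where
  zero: "0 \<in> add_span S"
| plus: "a \<in> S \<Longrightarrow> b \<in> add_span S \<Longrightarrow> a + b \<in> add_span S"

lemma add_span_add: "a \<in> add_span S \<Longrightarrow> b \<in> add_span S \<Longrightarrow> a + b \<in> add_span S"
  by (induction rule: add_span.induct) (auto simp: add.assoc intro: add_span.intros)

lemma add_span_superset: "a \<in> S \<Longrightarrow> a \<in> add_span S"
  using add_span.plus[OF _ add_span.zero] by force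

text \<open>The coefficient set is a parameter because Nakayama's argument compares combinations
  over the whole polynomial ring with combinations over the ideal itself.\<close>

definition comb :: "'a::comm_ring_1 set \<Rightarrow> 'a set \<Rightarrow> 'a set" where
  "comb C H = {\<Sum>h\<in>H. c h * h | c. \<forall>h\<in>H. c h \<in> C}"

lemma comb_empty [simp]: "comb C {} = {0}"
  by (auto simp: comb_def)

lemma comb_insert:
  assumes "finite H" "h \<notin> H"
  shows "p \<in> comb C (insert h H) \<longleftrightarrow> (\<exists>r\<in>C. \<exists>q\<in>comb C H. p = r * h + q)"
proof
  assume "p \<in> comb C (insert h H)"
  then obtain c where "\<forall>x\<in>insert h H. c x \<in> C" "p = c h * h + (\<Sum>x\<in>H. c x * x)"
    using assms by (auto simp: comb_def)
  then show "\<exists>r\<in>C. \<exists>q\<in>comb C H. p = r * h + q"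
    unfolding comb_def by blast
next
  assume "\<exists>r\<in>C. \<exists>q\<in>comb C H. p = r * h + q"
  then obtain r c where rc: "r \<in> C" "\<forall>x\<in>H. c x \<in> C" "p = r * h + (\<Sum>x\<in>H. c x * x)"
    by (auto simp: comb_def)
  have "(\<Sum>x\<in>H. c x * x) = (\<Sum>x\<in>H. (c(h := r)) x * x)"
    using assms(2) by (intro sum.cong) auto
  then have "p = (\<Sum>x\<in>insert h H. (c(h := r)) x * x)"
    using assms rc(3) by simp
  moreover have "\<forall>x\<in>insert h H. (c(h := r)) x \<in> C"
    using rc by auto
  ultimately show "p \<in> comb C (insert h H)"
    unfolding comb_def by blast
qed

lemma comb_add:
  assumes "\<And>a b. a \<in> C \<Longrightarrow> b \<in> C \<Longrightarrow> a + b \<in> C" "p \<in> comb C H" "q \<in> comb C H"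
  shows "p + q \<in> comb C H"
proof -
  obtain c d where "\<forall>h\<in>H. c h \<in> C" "p = (\<Sum>h\<in>H. c h * h)" "\<forall>h\<in>H. d h \<in> C" "q = (\<Sum>h\<in>H. d h * h)"
    using assms(2,3) by (auto simp: comb_def)
  then have "p + q = (\<Sum>h\<in>H. (c h + d h) * h)" "\<forall>h\<in>H. c h + d h \<in> C"
    using assms(1) by (auto simp: sum.distrib distrib_right)
  then show ?thesis
    unfolding comb_def by (intro CollectI exI[of _ "\<lambda>h. c h + d h"]) simp
qed

lemma comb_mult:
  assumes "\<And>x. x \<in> C \<Longrightarrow> a * x \<in> D" "p \<in> comb C H"
  shows "a * p \<in> comb D H"
proof -
  obtain c where "\<forall>h\<in>H. c h \<in> C" "p = (\<Sum>h\<in>H. c h * h)"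
    using assms(2) by (auto simp: comb_def)
  then have "a * p = (\<Sum>h\<in>H. (a * c h) * h)" "\<forall>h\<in>H. a * c h \<in> D"
    using assms(1) by (auto simp: sum_distrib_left mult.assoc)
  then show ?thesis
    unfolding comb_def by (intro CollectI exI[of _ "\<lambda>h. a * c h"]) simp
qed

lemma comb_zero: "0 \<in> C \<Longrightarrow> 0 \<in> comb C H"
  unfolding comb_def by (auto intro!: exI[of _ "\<lambda>_. 0"])

text \<open>\<open>good\<close> says that divisibility inside \<open>E\<close> is a
  well-quasi-order; the linear order of the type serves as a monomial order and supplies leading
  exponents.\<close>

locale dickson_monoid =
  fixes E :: "'m::{ordered_cancel_comm_monoid_add, linorder} set"
  assumes zero_mem: "0 \<in> E"
    and add_mem: "a \<in> E \<Longrightarrow> b \<in> E \<Longrightarrow> a + b \<in> E"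
    and nonneg: "a \<in> E \<Longrightarrow> 0 \<le> a"
    and good: "(\<And>n::nat. s n \<in> E) \<Longrightarrow> \<exists>i j. i < j \<and> (\<exists>c\<in>E. s j = s i + c)"
begin

text \<open>A descending chain would by \<open>good\<close> contain a term that is a multiple of an
  earlier one, hence not below it. The restriction to \<open>E\<close> matters: lexicographically,
  infinitely many variables already form a descending chain.\<close>

lemma wf_order: "wf {(a, b). a \<in> E \<and> b \<in> E \<and> a < b}"
proof (rule ccontr)
  assume "\<not> ?thesis"
  then obtain s where "\<forall>n. (s (Suc n), s n) \<in> {(a, b). a \<in> E \<and> b \<in> E \<and> a < b}"
    unfolding wf_iff_no_infinite_down_chain by blast
  then have s: "s n \<in> E" "s (Suc n) < s n" for n
    by auto
  obtain i j c where ij: "i < j" "c \<in> E" "s j = s i + c"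
    using good[of s] s(1) by blast
  have "s j < s i"
    using ij(1) by (induction i j rule: less_Suc_induct) (auto intro: s(2) less_trans)
  moreover have "s i \<le> s j"
    using nonneg[OF ij(2)] ij(3) by (simp add: add_increasing2)
  ultimately show False
    by simp
qed

text \<open>Dickson's lemma: otherwise one could keep choosing elements of \<open>L\<close> that are
  no multiples of the earlier ones, against \<open>good\<close>.\<close>

lemma finite_generators:
  assumes "L \<subseteq> E"
  shows "\<exists>B\<subseteq>L. finite B \<and> (\<forall>a\<in>L. \<exists>b\<in>B. \<exists>c\<in>E. a = b + c)"
proof (rule ccontr)
  assume "\<not> ?thesis"
  then have neg: "\<exists>a\<in>L. \<forall>b\<in>B. \<forall>c\<in>E. a \<noteq> b + c" if "B \<subseteq> L" "finite B" for B
    using that by meson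
  have "\<exists>s. \<forall>n::nat. s n \<in> L \<and> (\<forall>m<n. \<forall>c\<in>E. s n \<noteq> s m + c)"
  proof (rule dependent_wf_choice[OF wf_less])
    fix x :: nat and f :: "nat \<Rightarrow> 'm"
    assume "\<And>y. (y, x) \<in> {(x, y). x < y} \<Longrightarrow> f y \<in> L \<and> (\<forall>m<y. \<forall>c\<in>E. f y \<noteq> f m + c)"
    then have "f ` {..<x} \<subseteq> L" "finite (f ` {..<x})"
      by auto
    then obtain a where "a \<in> L" "\<forall>b\<in>f ` {..<x}. \<forall>c\<in>E. a \<noteq> b + c"
      using neg by meson
    then show "\<exists>r. r \<in> L \<and> (\<forall>m<x. \<forall>c\<in>E. r \<noteq> f m + c)"
      by (intro exI[of _ a]) simp
  qed auto
  then obtain s where s: "\<And>n::nat. s n \<in> L \<and> (\<forall>m<n. \<forall>c\<in>E. s n \<noteq> s m + c)"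
    by metis
  then have "s n \<in> E" for n
    using assms by blast
  then obtain i j c where "i < j" "c \<in> E" "s j = s i + c"
    using good[of s] by metis
  then show False
    using s by simp
qed

definition polys :: "('m \<Rightarrow>\<^sub>0 'k::field) set" where
  "polys = {p. keys p \<subseteq> E}"

lemma polys_zero: "0 \<in> polys"
  by (simp add: polys_def)

lemma polys_add: "p \<in> polys \<Longrightarrow> q \<in> polys \<Longrightarrow> p + q \<in> polys"
  using keys_add[of p q] by (auto simp: polys_def)

lemma polys_mult: "p \<in> polys \<Longrightarrow> q \<in> polys \<Longrightarrow> p * q \<in> polys"
  using keys_mult[of p q] add_mem unfolding polys_def by blast

lemma polys_single: "a \<in> E \<Longrightarrow> Poly_Mapping.single a x \<in> polys"
  by (auto simp: polys_def)

lemma polys_uminus: "p \<in> polys \<Longrightarrow> - p \<in> polys"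
  by (simp add: polys_def keys_def)

lemma polys_minus: "p \<in> polys \<Longrightarrow> q \<in> polys \<Longrightarrow> p - q \<in> polys"
  using polys_add[OF _ polys_uminus, of p q] by simp

lemma polys_one: "1 \<in> polys"
  using zero_mem by (simp add: polys_def)

lemma comb_polys_add: "p \<in> comb polys H \<Longrightarrow> q \<in> comb polys H \<Longrightarrow> p + q \<in> comb polys H"
  by (rule comb_add[of polys]) (auto intro: polys_add)

lemma comb_polys_mult: "r \<in> polys \<Longrightarrow> p \<in> comb polys H \<Longrightarrow> r * p \<in> comb polys H"
  by (rule comb_mult[of polys]) (auto intro: polys_mult)

definition polys_ideal :: "('m \<Rightarrow>\<^sub>0 'k::field) set \<Rightarrow> bool" where
  "polys_ideal J \<longleftrightarrow> J \<subseteq> polys \<and> 0 \<in> J \<and> (\<forall>p\<in>J. \<forall>q\<in>J. p + q \<in> J) \<and> (\<forall>r\<in>polys. \<forall>p\<in>J. r * p \<in> J)"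

lemma polys_ideal_minus: "polys_ideal J \<Longrightarrow> p \<in> J \<Longrightarrow> q \<in> J \<Longrightarrow> p - q \<in> J"
  using polys_uminus[OF polys_one] unfolding polys_ideal_def
  by (metis add_uminus_conv_diff mult_minus1)

text \<open>Subtracting from \<open>p\<close> a suitable monomial multiple of a generator lowers the leading exponent.\<close>

theorem hilbert_basis:
  assumes J: "polys_ideal (J :: ('m \<Rightarrow>\<^sub>0 'k::field) set)"
  shows "\<exists>G\<subseteq>J. finite G \<and> J \<subseteq> comb polys G"
proof -
  define lead :: "('m \<Rightarrow>\<^sub>0 'k) \<Rightarrow> 'm" where "lead p = Max (keys p)" for p
  have lead_in: "lead p \<in> keys p" if "p \<noteq> 0" for p
    using that by (simp add: lead_def)
  have lead_ge: "a \<le> lead p" if "a \<in> keys p" for a p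
    using that by (simp add: lead_def)
  have lead_E: "lead p \<in> E" if "p \<in> J" "p \<noteq> 0" for p
    using lead_in[OF that(2)] that(1) J by (auto simp: polys_ideal_def polys_def)
  define L where "L = lead ` (J - {0})"
  have "L \<subseteq> E"
    using lead_E by (auto simp: L_def)
  then obtain B where B: "B \<subseteq> L" "finite B" "\<And>a. a \<in> L \<Longrightarrow> \<exists>b\<in>B. \<exists>c\<in>E. a = b + c"
    using finite_generators by metis
  obtain g where g: "\<And>b. b \<in> B \<Longrightarrow> g b \<in> J \<and> g b \<noteq> 0 \<and> lead (g b) = b"
  proof -
    have "\<exists>p. p \<in> J \<and> p \<noteq> 0 \<and> lead p = b" if "b \<in> B" for b
      using B(1) that by (auto simp: L_def)
    then show thesis
      using that by metis
  qed
  define G where "G = g ` B"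
  have fin: "finite G"
    using B(2) by (simp add: G_def)
  \<comment> \<open>Division by the \<open>g b\<close>, by induction on the leading exponent;
    \<open>wf_order\<close> applies because leading exponents of members of \<open>J\<close> lie in
    \<open>E\<close>.\<close>
  have mem: "p \<in> comb polys G" if "p \<in> J" "p \<noteq> 0" "a = lead p" for p a
    using that
  proof (induction a arbitrary: p rule: wf_induct_rule[OF wf_order])
    case (1 a)
    then have "a \<in> L"
      by (auto simp: L_def)
    then obtain b c where bc: "b \<in> B" "c \<in> E" "a = b + c"
      using B(3) by blast
    define k where "k = lookup p a / lookup (g b) b"
    define q where "q = Poly_Mapping.single c k"
    have gb: "g b \<in> J" "g b \<in> G" "lookup (g b) b \<noteq> 0"
      using g[OF bc(1)] lead_in[of "g b"] bc(1) by (auto simp: G_def in_keys_iff)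
    have keys_g: "keys (g b) \<subseteq> {..b}"
      using g[OF bc(1)] lead_ge[of _ "g b"] by auto
    have qR: "q \<in> polys"
      unfolding q_def by (rule polys_single[OF bc(2)])
    have qg: "q * g b \<in> J"
      using J qR gb(1) by (simp add: polys_ideal_def)
    have qg_comb: "q * g b \<in> comb polys G"
    proof -
      have "q * g b = (\<Sum>h\<in>G. (if h = g b then q else 0) * h)"
        using fin gb(2) by (simp add: sum.delta if_distrib[of "\<lambda>x. x * _"] cong: if_cong)
      moreover have "\<forall>h\<in>G. (if h = g b then q else 0) \<in> polys"
        using qR polys_zero by auto
      ultimately show ?thesis
        unfolding comb_def by (intro CollectI exI[of _ "\<lambda>h. if h = g b then q else 0"]) simp
    qed
    \<comment> \<open>With the leading term \<open>s\<close> of \<open>g b\<close> split off,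
      \<open>q * s\<close> is exactly the leading term of \<open>p\<close> by the choice of
      \<open>k\<close>, and cancellation in the exponents keeps \<open>q * t\<close> strictly below
      \<open>a\<close>.\<close>
    define s where "s = Poly_Mapping.single b (lookup (g b) b)"
    define t where "t = g b - s"
    have t: "keys t \<subseteq> {..<b}"
    proof
      fix x assume "x \<in> keys t"
      then have "x \<noteq> b" "x \<in> keys (g b)"
        by (auto simp: t_def s_def in_keys_iff lookup_minus lookup_single when_def split: if_splits)
      then show "x \<in> {..<b}"
        using keys_g by (auto simp: le_less)
    qed
    have kt: "keys (q * t) \<subseteq> {..<a}"
    proof
      fix x assume "x \<in> keys (q * t)"
      then obtain y z where "x = y + z" "y \<in> keys q" "z \<in> keys t"
        using keys_mult[of q t] by blast
      then have "x = c + z" "z < b"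
        using t by (auto simp: q_def split: if_splits)
      then show "x \<in> {..<a}"
        by (simp add: bc(3) add.commute[of b c] add_strict_left_mono)
    qed
    have "q * s = Poly_Mapping.single a (lookup p a)"
      using gb(3) by (simp add: s_def q_def k_def mult_single bc(3) add.commute)
    moreover have "q * g b = q * s + q * t"
      by (simp add: t_def right_diff_distrib)
    ultimately have eq: "q * g b = Poly_Mapping.single a (lookup p a) + q * t"
      by simp
    define p' where "p' = p - q * g b"
    have "keys p' \<subseteq> {..<a}"
    proof
      fix x assume x: "x \<in> keys p'"
      have nt: "lookup (q * t) x = 0" if "\<not> x < a"
        using kt that by (auto simp: in_keys_iff)
      have "\<not> x < a \<Longrightarrow> lookup p x = 0" if "x \<noteq> a"
        using lead_ge[of x p] 1(4) that by (auto simp: in_keys_iff)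
      then have "\<not> x < a \<Longrightarrow> lookup p' x = 0"
        using nt unfolding p'_def eq
        by (cases "x = a") (auto simp: lookup_minus lookup_add lookup_single when_def)
      then show "x \<in> {..<a}"
        using x by (auto simp: in_keys_iff)
    qed
    moreover have p'J: "p' \<in> J"
      unfolding p'_def using polys_ideal_minus[OF J 1(2) qg] .
    ultimately have "p' \<in> comb polys G"
      using 1(1)[of "lead p'" p'] lead_in[of p'] lead_E[of p'] lead_E[OF 1(2,3)] 1(4) comb_zero[OF polys_zero]
      by (cases "p' = 0") auto
    then have "p' + q * g b \<in> comb polys G"
      using qg_comb by (rule comb_polys_add)
    then show ?case
      by (simp add: p'_def)
  qed
  have "J \<subseteq> comb polys G"
  proof
    fix p assume "p \<in> J"
    then show "p \<in> comb polys G"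
      using mem comb_zero[OF polys_zero] by (cases "p = 0") auto
  qed
  moreover have "G \<subseteq> J"
    using g by (auto simp: G_def)
  ultimately show ?thesis
    using fin by blast
qed

text \<open>Nakayama's lemma localised at the powers of \<open>x\<close>: eliminating the generators one by one produces
  an element of \<open>J\<close> that differs from a power of \<open>x\<close> by an annihilator of \<open>J\<close>.\<close>

theorem power_in_locally_idempotent_ideal:
  fixes J :: "('m \<Rightarrow>\<^sub>0 'k::field) set"
  assumes J: "polys_ideal J" and nz: "b \<in> J" "b \<noteq> 0" and x: "x \<in> polys"
    and idem: "\<And>p. p \<in> J \<Longrightarrow> \<exists>s. x ^ s * p \<in> add_span {c * d | c d. c \<in> J \<and> d \<in> J}"
  shows "\<exists>s. x ^ s \<in> J"
proof -
  have sub: "J \<subseteq> polys" and J0: "0 \<in> J" and Jadd: "\<And>p q. p \<in> J \<Longrightarrow> q \<in> J \<Longrightarrow> p + q \<in> J"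
    and Jmul: "\<And>r p. r \<in> polys \<Longrightarrow> p \<in> J \<Longrightarrow> r * p \<in> J"
    using J by (auto simp: polys_ideal_def)
  have xp: "x ^ s \<in> polys" for s
    by (induction s) (auto intro: polys_one polys_mult x)
  obtain G where G: "G \<subseteq> J" "finite G" "J \<subseteq> comb polys G"
    using hilbert_basis[OF J] by blast
  \<comment> \<open>\<open>K\<close> holds the generators already eliminated, \<open>H\<close> those
    still allowed. The start \<open>H = G\<close> is trivial with \<open>s = 0\<close> and
    \<open>e = 0\<close>; at \<open>H = {}\<close> the combinations have shrunk to 0.\<close>
  have "\<exists>s. \<exists>e\<in>J. \<forall>p\<in>J. (x ^ s - e) * p \<in> comb polys H" if "finite H" "H \<subseteq> J" "finite K" "K \<union> H = G" "K \<inter> H = {}" for H K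
    using that(3,1,2,4,5)
  proof (induction K arbitrary: H rule: finite_induct)
    case empty
    then have "(x ^ 0 - 0) * p \<in> comb polys H" if "p \<in> J" for p
      using G(3) that by auto
    then show ?case
      using J0 by blast
  next
    case (insert h K)
    have h: "h \<in> J" "h \<notin> H" "finite H"
      using insert.prems G(1) by auto
    have "\<exists>s. \<exists>e\<in>J. \<forall>p\<in>J. (x ^ s - e) * p \<in> comb polys (insert h H)"
      using insert.prems insert.hyps h G(1) by (intro insert.IH) auto
    then obtain s e where e: "e \<in> J" and u: "\<And>p. p \<in> J \<Longrightarrow> (x ^ s - e) * p \<in> comb polys (insert h H)"
      by blast
    define u where "u = x ^ s - e"
    have uR: "u \<in> polys"
      unfolding u_def using xp e sub by (auto intro: polys_minus)
    obtain t where t: "x ^ t * h \<in> add_span {c * d | c d. c \<in> J \<and> d \<in> J}"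
      using idem[OF h(1)] by blast
    \<comment> \<open>In each product \<open>c * d\<close> the factor \<open>u\<close> is spent on
      \<open>d\<close>, and \<open>c\<close> then moves the resulting coefficients into
      \<open>J\<close>.\<close>
    have "u * y \<in> comb J (insert h H)" if "y \<in> add_span {c * d | c d. c \<in> J \<and> d \<in> J}" for y
      using that
    proof (induction rule: add_span.induct)
      case zero
      then show ?case
        by (simp add: comb_zero[OF J0])
    next
      case (plus a y)
      then obtain c d where cd: "a = c * d" "c \<in> J" "d \<in> J"
        by blast
      have "c * (u * d) \<in> comb J (insert h H)"
        unfolding u_def
      proof (rule comb_mult[OF _ u[OF cd(3)]])
        show "c * x \<in> J" if "x \<in> polys" for x
          using Jmul[OF that cd(2)] by (simp add: mult.commute)
      qed
      then show ?case
        using comb_add[OF Jadd _ plus.IH, of "u * a"] cd(1) by (simp add: algebra_simps)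
    qed
    from this[OF t] obtain r q where r: "r \<in> J" "q \<in> comb J H" "u * (x ^ t * h) = r * h + q"
      unfolding comb_insert[OF h(3,2)] by blast
    \<comment> \<open>\<open>x ^ t * h\<close> is a sum of products, so after multiplication by
      \<open>u\<close> its coefficient \<open>r\<close> at \<open>h\<close> lies in
      \<open>J\<close>. Moving that term to the left, \<open>w\<close> sends \<open>h\<close> into
      the combinations of \<open>H\<close>.\<close>
    define w where "w = u * x ^ t - r"
    have "q \<in> comb polys H"
      using comb_mult[of J 1 polys q H] r(2) sub by auto
    then have wh: "w * h \<in> comb polys H"
      using r(3) by (simp add: w_def algebra_simps)
    have wR: "w \<in> polys"
      unfolding w_def using uR xp r(1) sub by (auto intro: polys_minus polys_mult)
    \<comment> \<open>Read off from the expansion of \<open>w * u\<close>: every term other than the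
      pure power of \<open>x\<close> lies in \<open>J\<close>.\<close>
    define e' where "e' = x ^ t * (x ^ s * e) + x ^ t * (u * e) + u * r"
    have e': "e' \<in> J"
      unfolding e'_def by (intro Jadd Jmul xp uR e r)
    have ww: "w * u = x ^ (s + s + t) - e'"
      by (simp add: w_def u_def e'_def algebra_simps power_add)
    have "(x ^ (s + s + t) - e') * p \<in> comb polys H" if p: "p \<in> J" for p
    proof -
      obtain z y where zy: "z \<in> polys" "y \<in> comb polys H" "u * p = z * h + y"
        using u[OF p] unfolding comb_insert[OF h(3,2)] u_def by blast
      have "(x ^ (s + s + t) - e') * p = w * (u * p)"
        by (simp only: ww[symmetric] mult.assoc)
      also have "\<dots> = z * (w * h) + w * y"
        unfolding zy(3) by (simp add: algebra_simps)
      also have "\<dots> \<in> comb polys H"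
        using comb_polys_mult[OF zy(1) wh] comb_polys_mult[OF wR zy(2)]
        by (rule comb_polys_add)
      finally show ?thesis .
    qed
    then show ?case
      using e' by blast
  qed
  \<comment> \<open>No generator is left, so \<open>x ^ s - e\<close> annihilates \<open>b\<close>.
    The polynomial ring is a domain and \<open>b\<close> is nonzero, hence
    \<open>x ^ s = e\<close>.\<close>
  from this[of "{}" G] G(2) obtain s e where "e \<in> J" "(x ^ s - e) * b = 0"
    using nz(1) by auto
  then have "x ^ s \<in> J"
    using nz(2) by simp
  then show ?thesis ..
qed

end

section \<open>The monoid algebra of bicyclic monoids\<close>

lemma poly_mapping_add_induct [case_names zero single add]:
  fixes a :: "'a \<Rightarrow>\<^sub>0 'b::comm_monoid_add"
  assumes "P 0" "\<And>k v. P (Poly_Mapping.single k v)" "\<And>a b. P a \<Longrightarrow> P b \<Longrightarrow> P (a + b)"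
  shows "P a"
proof (induction a rule: update_induct)
  case (update f a b)
  have "Poly_Mapping.update a b f = Poly_Mapping.single a b + f"
    using update(1) by (intro poly_mapping_eqI) (auto simp: lookup_update lookup_add lookup_single when_def in_keys_iff)
  then show ?case
    using assms update by simp
qed (fact assms)

lemma poly_mapping_expand: "(\<Sum>k\<in>keys a. Poly_Mapping.single k (lookup a k)) = a"
  by (rule poly_mapping_eqI) (simp add: lookup_sum lookup_single when_def in_keys_iff)

text \<open>The wrapper lets monomials carry a noncommutative addition, namely the bicyclic product
  in each coordinate. The convolution product of \<open>\<Rightarrow>\<^sub>0\<close> over this
  monoid is then the multiplication of the algebra.\<close>

datatype 'n jmon = Mon (exps: "'n mon")

lemma bmul_assoc: "bmul (bmul p q) r = bmul p (bmul q r)"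
  by (auto simp: bmul_def min_def)

lemma bmul_one [simp]: "bmul (0, 0) p = p" "bmul p (0, 0) = p"
  by (auto simp: bmul_def)

instantiation jmon :: (type) monoid_add
begin

definition "0 = Mon (\<lambda>_. (0, 0))"
definition "p + q = Mon (mmul (exps p) (exps q))"

instance
  by standard (simp_all add: zero_jmon_def plus_jmon_def mmul_def bmul_assoc)

end

type_synonym ('n, 'k) jac = "'n jmon \<Rightarrow>\<^sub>0 'k"

definition jmono :: "'n mon \<Rightarrow> ('n, 'k::field) jac" where
  "jmono m = Poly_Mapping.single (Mon m) 1"

definition xpow :: "'n set \<Rightarrow> nat \<Rightarrow> ('n, 'k::field) jac" where
  "xpow W N = jmono (\<lambda>i. if i \<in> W then (N, 0) else (0, 0))"

definition ypow :: "'n set \<Rightarrow> nat \<Rightarrow> ('n, 'k::field) jac" where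
  "ypow W N = jmono (\<lambda>i. if i \<in> W then (0, N) else (0, 0))"

lemma jmono_mult: "jmono m * jmono m' = jmono (mmul m m')"
  by (simp add: jmono_def mult_single plus_jmon_def)

lemma jmono_one: "jmono (\<lambda>_. (0, 0)) = 1"
  unfolding jmono_def zero_jmon_def[symmetric] by simp

lemma jmono_commute:
  assumes "\<And>i. m i = (0, 0) \<or> m' i = (0, 0)"
  shows "jmono m * jmono m' = jmono m' * jmono m"
proof -
  have "bmul (m i) (m' i) = bmul (m' i) (m i)" for i
    using assms[of i] by auto
  then show ?thesis
    by (simp add: jmono_mult mmul_def)
qed

lemma scalar_commute: "Poly_Mapping.single 0 k * a = a * Poly_Mapping.single 0 k"
  for a :: "('n, 'k::field) jac"
  by (induction a rule: poly_mapping_add_induct) (simp_all add: mult_single mult.commute algebra_simps)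

lemma single_eq_scalar_jmono: "Poly_Mapping.single (Mon m) k = Poly_Mapping.single 0 k * jmono m"
  by (simp add: jmono_def mult_single)

lemma jac_induct [case_names jmono scalar add]:
  fixes a :: "('n, 'k::field) jac"
  assumes "\<And>m. P (jmono m)" "\<And>k a. P a \<Longrightarrow> P (Poly_Mapping.single 0 k * a)" "\<And>a b. P a \<Longrightarrow> P b \<Longrightarrow> P (a + b)"
  shows "P a"
proof (induction a rule: poly_mapping_add_induct)
  case zero
  show ?case
    using assms(2)[OF assms(1), of 0] by simp
next
  case (single m k)
  show ?case
    using assms(2)[OF assms(1)] by (cases m) (simp add: single_eq_scalar_jmono)
qed (fact assms(3))

lemma xpow_0 [simp]: "xpow W 0 = 1" and xpow_empty [simp]: "xpow {} N = 1"
  and ypow_0 [simp]: "ypow W 0 = 1" and ypow_empty [simp]: "ypow {} N = 1"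
  by (simp_all add: xpow_def ypow_def jmono_one)

lemma xpow_add: "xpow W (M + N) = xpow W M * xpow W N"
  by (auto simp: xpow_def jmono_mult mmul_def bmul_def intro!: arg_cong[of _ _ jmono])

lemma ypow_add: "ypow W (M + N) = ypow W M * ypow W N"
  by (auto simp: ypow_def jmono_mult mmul_def bmul_def intro!: arg_cong[of _ _ jmono])

lemma ypow_xpow [simp]: "ypow W N * xpow W N = 1"
  unfolding xpow_def ypow_def jmono_mult jmono_one[symmetric]
  by (auto simp: mmul_def bmul_def intro!: arg_cong[of _ _ jmono])

lemma ypow_xpow_assoc [simp]: "ypow W N * (xpow W N * a) = a"
  by (simp add: mult.assoc[symmetric])

lemma xpow_insert: "j \<notin> W \<Longrightarrow> xpow (insert j W) N = xpow {j} N * xpow W N"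
  by (auto simp: xpow_def jmono_mult mmul_def bmul_def intro!: arg_cong[of _ _ jmono])

section \<open>Two-sided ideals and torsion with respect to the generators\<close>

definition tideal :: "'a::ring_1 set \<Rightarrow> bool" where
  "tideal I \<longleftrightarrow> 0 \<in> I \<and> (\<forall>a\<in>I. \<forall>b\<in>I. a + b \<in> I) \<and> (\<forall>r. \<forall>a\<in>I. r * a \<in> I \<and> a * r \<in> I)"

lemma tidealI:
  assumes "0 \<in> I" "\<And>a b. a \<in> I \<Longrightarrow> b \<in> I \<Longrightarrow> a + b \<in> I"
    "\<And>r a. a \<in> I \<Longrightarrow> r * a \<in> I" "\<And>r a. a \<in> I \<Longrightarrow> a * r \<in> I"
  shows "tideal I"
  using assms by (auto simp: tideal_def)

context
  fixes I :: "'a::ring_1 set"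
  assumes I: "tideal I"
begin

lemma tideal_zero: "0 \<in> I"
  and tideal_add: "a \<in> I \<Longrightarrow> b \<in> I \<Longrightarrow> a + b \<in> I"
  and tideal_mult_left: "a \<in> I \<Longrightarrow> r * a \<in> I"
  and tideal_mult_right: "a \<in> I \<Longrightarrow> a * r \<in> I"
  using I by (auto simp: tideal_def)

end

definition xtors :: "'n set \<Rightarrow> ('n, 'k::field) jac set" where
  "xtors W = {a. \<exists>N. a * xpow W N = 0}"

definition ytors :: "'n set \<Rightarrow> ('n, 'k::field) jac set" where
  "ytors W = {a. \<exists>N. ypow W N * a = 0}"

text \<open>An Ore condition: sufficiently many \<open>x_i\<close> absorb the \<open>y_i\<close> of
  \<open>m\<close> and still leave \<open>N\<close> of them to be moved to the front. This is what
  makes right torsion stable under multiplication from the right.\<close>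

lemma jmono_xpow_shift:
  fixes m :: "('n::finite) mon"
  shows "\<exists>m' N'. jmono m * xpow W N' = xpow W N * (jmono m' :: ('n, 'k::field) jac)"
proof -
  define N' where "N' = N + (\<Sum>i\<in>UNIV. snd (m i))"
  define m' where "m' = (\<lambda>i. if i \<in> W then (fst (m i) + (N' - N) - snd (m i), 0) else m i)"
  have *: "snd (m i) \<le> N'" "snd (m i) + N \<le> N'" for i
    using member_le_sum[of i UNIV "\<lambda>i. snd (m i)"] by (simp_all add: N'_def)
  have "N \<le> N'"
    by (simp add: N'_def)
  then have "bmul (m i) (if i \<in> W then (N', 0) else (0, 0)) = bmul (if i \<in> W then (N, 0) else (0, 0)) (m' i)" for i
    using *[of i] by (auto simp: bmul_def m'_def min_def)
  then have "jmono m * xpow W N' = xpow W N * jmono m'"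
    by (simp add: xpow_def jmono_mult mmul_def)
  then show ?thesis
    by blast
qed

lemma jmono_ypow_shift:
  fixes m :: "('n::finite) mon"
  shows "\<exists>m' N'. ypow W N' * jmono m = (jmono m' :: ('n, 'k::field) jac) * ypow W N"
proof -
  define N' where "N' = N + (\<Sum>i\<in>UNIV. fst (m i))"
  define m' where "m' = (\<lambda>i. if i \<in> W then (0, snd (m i) + (N' - N) - fst (m i)) else m i)"
  have *: "fst (m i) \<le> N'" "fst (m i) + N \<le> N'" for i
    using member_le_sum[of i UNIV "\<lambda>i. fst (m i)"] by (simp_all add: N'_def)
  have "N \<le> N'"
    by (simp add: N'_def)
  then have "bmul (if i \<in> W then (0, N') else (0, 0)) (m i) = bmul (m' i) (if i \<in> W then (0, N) else (0, 0))" for i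
    using *[of i] by (auto simp: bmul_def m'_def min_def)
  then have "ypow W N' * jmono m = jmono m' * ypow W N"
    by (simp add: ypow_def jmono_mult mmul_def)
  then show ?thesis
    by blast
qed

lemma xtors_mono:
  assumes "a * xpow W N = 0" "N \<le> M"
  shows "a * xpow W M = 0"
proof -
  have "a * xpow W M = a * xpow W N * xpow W (M - N)"
    unfolding mult.assoc xpow_add[symmetric] using assms(2) by simp
  then show ?thesis
    by (simp add: assms(1))
qed

lemma ytors_mono:
  assumes "ypow W N * a = 0" "N \<le> M"
  shows "ypow W M * a = 0"
proof -
  have "ypow W M * a = ypow W (M - N) * (ypow W N * a)"
    unfolding mult.assoc[symmetric] ypow_add[symmetric] using assms(2) by simp
  then show ?thesis
    by (simp add: assms(1))
qed

lemma xtors_add: "a \<in> xtors W \<Longrightarrow> b \<in> xtors W \<Longrightarrow> a + b \<in> xtors W"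
proof -
  assume "a \<in> xtors W" "b \<in> xtors W"
  then obtain M N where "a * xpow W M = 0" "b * xpow W N = 0"
    by (auto simp: xtors_def)
  then have "(a + b) * xpow W (max M N) = 0"
    using xtors_mono[of a W M "max M N"] xtors_mono[of b W N "max M N"] by (simp add: distrib_right)
  then show "a + b \<in> xtors W"
    by (auto simp: xtors_def)
qed

lemma ytors_add: "a \<in> ytors W \<Longrightarrow> b \<in> ytors W \<Longrightarrow> a + b \<in> ytors W"
proof -
  assume "a \<in> ytors W" "b \<in> ytors W"
  then obtain M N where "ypow W M * a = 0" "ypow W N * b = 0"
    by (auto simp: ytors_def)
  then have "ypow W (max M N) * (a + b) = 0"
    using ytors_mono[of W M a "max M N"] ytors_mono[of W N b "max M N"] by (simp add: distrib_left)
  then show "a + b \<in> ytors W"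
    by (auto simp: ytors_def)
qed

lemma xtors_tideal: "tideal (xtors W :: ('n::finite, 'k::field) jac set)"
proof (rule tidealI)
  fix r a :: "('n, 'k) jac"
  assume "a \<in> xtors W"
  then obtain N where N: "a * xpow W N = 0"
    by (auto simp: xtors_def)
  then have "r * a * xpow W N = 0"
    by (simp add: mult.assoc)
  then show "r * a \<in> xtors W"
    by (auto simp: xtors_def)
  show "a * r \<in> xtors W"
  proof (induction r rule: jac_induct)
    case (jmono m)
    obtain m' N' where "jmono m * xpow W N' = xpow W N * (jmono m' :: ('n, 'k) jac)"
      using jmono_xpow_shift by blast
    then have "a * jmono m * xpow W N' = (a * xpow W N) * jmono m'"
      by (simp add: mult.assoc)
    then show ?case
      using N by (auto simp: xtors_def)
  next
    case (scalar k r)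
    then obtain M where "a * r * xpow W M = 0"
      by (auto simp: xtors_def)
    moreover have "a * (Poly_Mapping.single 0 k * r) = Poly_Mapping.single 0 k * (a * r)"
      by (simp only: mult.assoc[symmetric] scalar_commute[of k a])
    ultimately have "a * (Poly_Mapping.single 0 k * r) * xpow W M = 0"
      by (simp add: mult.assoc)
    then show ?case
      by (auto simp: xtors_def)
  qed (simp add: distrib_left xtors_add)
next
  show "0 \<in> (xtors W :: ('n, 'k) jac set)"
    by (simp add: xtors_def)
qed (rule xtors_add)

lemma ytors_tideal: "tideal (ytors W :: ('n::finite, 'k::field) jac set)"
proof (rule tidealI)
  fix r a :: "('n, 'k) jac"
  assume "a \<in> ytors W"
  then obtain N where N: "ypow W N * a = 0"
    by (auto simp: ytors_def)
  then have "ypow W N * (a * r) = 0"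
    by (simp add: mult.assoc[symmetric])
  then show "a * r \<in> ytors W"
    by (auto simp: ytors_def)
  show "r * a \<in> ytors W"
  proof (induction r rule: jac_induct)
    case (jmono m)
    obtain m' N' where "ypow W N' * jmono m = (jmono m' :: ('n, 'k) jac) * ypow W N"
      using jmono_ypow_shift by blast
    then have "ypow W N' * (jmono m * a) = jmono m' * (ypow W N * a)"
      by (simp add: mult.assoc[symmetric])
    then show ?case
      using N by (auto simp: ytors_def)
  next
    case (scalar k r)
    then obtain M where "ypow W M * (r * a) = 0"
      by (auto simp: ytors_def)
    moreover have "ypow W M * (Poly_Mapping.single 0 k * r * a) = Poly_Mapping.single 0 k * (ypow W M * (r * a))"
      by (simp only: mult.assoc[symmetric] scalar_commute[of k "ypow W M"])
    ultimately have "ypow W M * (Poly_Mapping.single 0 k * r * a) = 0"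
      by simp
    then show ?case
      by (auto simp: ytors_def)
  qed (simp add: distrib_right ytors_add)
next
  show "0 \<in> (ytors W :: ('n, 'k) jac set)"
    by (simp add: ytors_def)
qed (rule ytors_add)

lemma xtors_antimono:
  assumes "V \<subseteq> W"
  shows "xtors V \<subseteq> xtors W"
proof
  fix a assume "a \<in> xtors V"
  then obtain N where N: "a * xpow V N = 0"
    by (auto simp: xtors_def)
  have "bmul (if i \<in> V then (N, 0) else (0, 0)) (if i \<in> W - V then (N, 0) else (0, 0)) = (if i \<in> W then (N, 0) else (0, 0))" for i
    using assms by (auto simp: bmul_def)
  then have "xpow W N = xpow V N * xpow (W - V) N"
    by (simp add: xpow_def jmono_mult mmul_def)
  from arg_cong[OF this, of "(*) a"] have "a * xpow W N = 0"
    using N by (simp add: mult.assoc[symmetric])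
  then show "a \<in> xtors W"
    by (auto simp: xtors_def)
qed

text \<open>The matrix unit \<open>E_00\<close> of \<open>F(j)\<close>; in general
  \<open>E_kl\<close> is \<open>xpow {j} k * proj j * ypow {j} l\<close>.\<close>

definition proj :: "'n \<Rightarrow> ('n, 'k::field) jac" where
  "proj j = 1 - xpow {j} 1 * ypow {j} 1"

lemma ypow_proj: "ypow {j} (Suc N) * proj j = 0"
proof -
  have *: "ypow {j} (Suc N) = ypow {j} N * ypow {j} 1"
    using ypow_add[of "{j}" N 1] by simp
  show ?thesis
    by (simp only: * proj_def right_diff_distrib mult.assoc ypow_xpow_assoc mult_1_right diff_self)
qed

lemma proj_xpow: "proj j * xpow {j} (Suc N) = 0"
proof -
  have *: "xpow {j} (Suc N) = xpow {j} 1 * xpow {j} N"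
    using xpow_add[of "{j}" 1 N] by simp
  show ?thesis
    by (simp only: * proj_def left_diff_distrib mult.assoc ypow_xpow_assoc mult_1_left diff_self)
qed

lemma proj_idem: "proj j * proj j = proj j"
proof -
  have "proj j * proj j = proj j - xpow {j} 1 * (ypow {j} 1 * proj j)"
    by (subst proj_def) (simp only: left_diff_distrib mult_1_left mult.assoc)
  then show ?thesis
    by (simp add: ypow_proj)
qed

lemma proj_jmono_commute:
  assumes "m j = (0, 0)"
  shows "proj j * jmono m = jmono m * proj j"
proof -
  have x: "xpow {j} 1 * jmono m = jmono m * xpow {j} 1" and y: "ypow {j} 1 * jmono m = jmono m * ypow {j} 1"
    unfolding xpow_def ypow_def using assms by (auto intro!: jmono_commute)
  have "xpow {j} 1 * ypow {j} 1 * jmono m = xpow {j} 1 * jmono m * ypow {j} 1"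
    unfolding mult.assoc y ..
  also have "\<dots> = jmono m * (xpow {j} 1 * ypow {j} 1)"
    unfolding mult.assoc[symmetric] x ..
  finally show ?thesis
    unfolding proj_def left_diff_distrib right_diff_distrib by simp
qed

text \<open>A telescoping sum: the diagonal matrix units \<open>E_kk\<close> with
  \<open>k < N\<close> add up to \<open>1 - x^N y^N\<close>.\<close>

lemma one_minus_xpow_ypow:
  "1 - xpow {j} N * ypow {j} N = (\<Sum>k<N. ( xpow {j} k * proj j * ypow {j} k) :: ('n, 'k::field) jac)"
proof (induction N)
  case (Suc N)
  have "xpow {j} (Suc N) * ypow {j} (Suc N) = xpow {j} N * (xpow {j} 1 * ypow {j} 1) * (ypow {j} N :: ('n, 'k) jac)"
    unfolding mult.assoc xpow_add[symmetric] ypow_add[symmetric] by (simp add: xpow_add[symmetric] mult.assoc[symmetric])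
  then have "1 - xpow {j} (Suc N) * ypow {j} (Suc N) =
      (1 - xpow {j} N * ypow {j} N) + xpow {j} N * proj j * (ypow {j} N :: ('n, 'k) jac)"
    by (simp add: proj_def left_diff_distrib right_diff_distrib)
  then show ?case
    by (simp add: Suc.IH)
qed simp

lemma one_minus_in_xtors: "1 - xpow W N * ypow W N \<in> xtors W"
  by (auto simp: xtors_def left_diff_distrib mult.assoc intro!: exI[of _ N])

lemma tideal_sum:
  assumes "tideal I" "\<And>x. x \<in> A \<Longrightarrow> f x \<in> I"
  shows "sum f A \<in> I"
  using assms(2) by (induction A rule: infinite_finite_induct) (auto intro: tideal_zero tideal_add assms(1))

text \<open>If \<open>a x^N = 0\<close> then \<open>a = a (1 - x^N y^N)\<close>, a sum of multiples
  of \<open>proj j\<close>, and \<open>y\<close> kills \<open>proj j\<close> from the left. This is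
  the source of the left-right symmetry behind left local units and the invariance under the
  involution.\<close>

lemma xtors_imp_ytors:
  assumes "a \<in> xtors {j}"
  shows "(a :: ('n::finite, 'k::field) jac) \<in> ytors {j}"
proof -
  obtain N where "a * xpow {j} N = 0"
    using assms by (auto simp: xtors_def)
  then have "a = a * (1 - xpow {j} N * ypow {j} N)"
    by (simp add: right_diff_distrib mult.assoc[symmetric])
  moreover have "(proj j :: ('n, 'k) jac) \<in> ytors {j}"
    unfolding ytors_def by (intro CollectI exI[of _ "Suc 0"] ypow_proj)
  then have "1 - xpow {j} N * ypow {j} N \<in> (ytors {j} :: ('n, 'k) jac set)"
    unfolding one_minus_xpow_ypow by (intro tideal_sum tideal_mult_left tideal_mult_right ytors_tideal)
  ultimately show ?thesis
    using tideal_mult_left[OF ytors_tideal] by metis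
qed

text \<open>Each index of \<open>Z\<close> must give torsion on its own, so the ideal shrinks as
  \<open>Z\<close> grows. For \<open>xtors W\<close> it is enough that the product of the variables
  is nilpotent on the element, so that ideal grows with \<open>W\<close>.\<close>

definition tors :: "'n set \<Rightarrow> ('n, 'k::field) jac set" where
  "tors Z = {a. \<forall>i\<in>Z. a \<in> xtors {i}}"

lemma tors_tideal: "tideal (tors Z :: ('n::finite, 'k::field) jac set)"
  using xtors_tideal by (fastforce simp: tors_def tideal_def)

lemma tors_antimono: "Z \<subseteq> Z' \<Longrightarrow> tors Z' \<subseteq> tors Z"
  by (auto simp: tors_def)

text \<open>The local unit is a product of factors \<open>1 - x_j^N y_j^N\<close>, one for each
  \<open>j\<close> in \<open>Z\<close>. It makes these ideals idempotent and allows elements of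
  \<open>tors Z\<close> to be inserted into products.\<close>

lemma tors_unit_right:
  assumes "(a :: ('n::finite, 'k::field) jac) \<in> tors Z"
  shows "\<exists>u\<in>tors Z. a * u = a"
proof -
  have "finite Z"
    by simp
  then show ?thesis
    using assms
  proof (induction Z rule: finite_induct)
    case (insert j Z)
    then obtain u N where u: "u \<in> tors Z" "a * u = a" "a * xpow {j} N = 0"
      by (auto simp: tors_def xtors_def)
    have "u * (1 - xpow {j} N * ypow {j} N) \<in> tors (insert j Z)"
      using tideal_mult_right[OF tors_tideal u(1)] tideal_mult_left[OF xtors_tideal one_minus_in_xtors]
      by (auto simp: tors_def)
    moreover have "a * (u * (1 - xpow {j} N * ypow {j} N)) = a"
      using u(2,3) by (simp add: mult.assoc[symmetric] right_diff_distrib)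
    ultimately show ?case
      by blast
  qed (auto simp: tors_def intro: exI[of _ 1])
qed

lemma tors_unit_left:
  assumes "(a :: ('n::finite, 'k::field) jac) \<in> tors Z"
  shows "\<exists>u\<in>tors Z. u * a = a"
proof -
  have "finite Z"
    by simp
  then show ?thesis
    using assms
  proof (induction Z rule: finite_induct)
    case (insert j Z)
    then have "a \<in> ytors {j}" "a \<in> tors Z"
      by (auto simp: tors_def xtors_imp_ytors)
    then obtain u N where u: "u \<in> tors Z" "u * a = a" "ypow {j} N * a = 0"
      using insert.IH by (auto simp: ytors_def)
    have "(1 - xpow {j} N * ypow {j} N) * u \<in> tors (insert j Z)"
      using tideal_mult_left[OF tors_tideal u(1)] tideal_mult_right[OF xtors_tideal one_minus_in_xtors]
      by (auto simp: tors_def)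
    moreover have "(1 - xpow {j} N * ypow {j} N) * u * a = a"
      using u(2,3) by (simp add: mult.assoc left_diff_distrib)
    ultimately show ?case
      by blast
  qed (auto simp: tors_def intro: exI[of _ 1])
qed

text \<open>The product of the idempotents \<open>proj j\<close> over \<open>j\<close> in
  \<open>Z\<close>. A predicate leaves the order of the factors open, as a product over a set in a
  noncommutative ring would require a choice; rule induction removes one factor at a time.\<close>

inductive corner :: "'n set \<Rightarrow> ('n, 'k::field) jac \<Rightarrow> bool" where
  empty: "corner {} 1"
| insert: "corner Z e \<Longrightarrow> j \<notin> Z \<Longrightarrow> corner (insert j Z) (e * proj j)"

lemma corner_exists: "\<exists>e. corner (Z :: 'n::finite set) (e :: ('n, 'k::field) jac)"
proof -
  have "finite Z"
    by simp
  then show ?thesis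
    by (induction Z rule: finite_induct) (auto intro: corner.intros)
qed

lemma corner_jmono_commute:
  "corner Z e \<Longrightarrow> (\<And>i. i \<in> Z \<Longrightarrow> m i = (0, 0)) \<Longrightarrow> e * jmono m = jmono m * e"
proof (induction rule: corner.induct)
  case (insert Z e j)
  then have *: "proj j * jmono m = jmono m * proj j"
    by (intro proj_jmono_commute) simp
  have "e * proj j * jmono m = e * jmono m * proj j"
    by (simp only: mult.assoc *)
  then show ?case
    using insert by (simp add: mult.assoc[symmetric])
qed simp

lemma corner_xpow_commute: "corner Z e \<Longrightarrow> Z \<inter> W = {} \<Longrightarrow> e * xpow W N = xpow W N * e"
  unfolding xpow_def by (rule corner_jmono_commute) auto

lemma corner_ypow_commute: "corner Z e \<Longrightarrow> Z \<inter> W = {} \<Longrightarrow> e * ypow W N = ypow W N * e"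
  unfolding ypow_def by (rule corner_jmono_commute) auto

lemma corner_proj_commute:
  assumes "corner Z e" "j \<notin> Z"
  shows "e * proj j = proj j * e"
proof -
  have x: "e * xpow {j} 1 = xpow {j} 1 * e" and y: "e * ypow {j} 1 = ypow {j} 1 * e"
    using assms corner_xpow_commute[of Z e "{j}" 1] corner_ypow_commute[of Z e "{j}" 1] by auto
  have "e * (xpow {j} 1 * ypow {j} 1) = xpow {j} 1 * (e * ypow {j} 1)"
    unfolding mult.assoc[symmetric] x ..
  then show ?thesis
    unfolding proj_def right_diff_distrib left_diff_distrib y by (simp add: mult.assoc)
qed

lemma corner_idem: "corner Z e \<Longrightarrow> e * e = e"
proof (induction rule: corner.induct)
  case (insert Z e j)
  have "e * proj j * (e * proj j) = e * (proj j * e) * proj j"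
    by (simp add: mult.assoc)
  also have "\<dots> = (e * e) * (proj j * proj j)"
    by (simp add: corner_proj_commute[OF insert(1,2), symmetric] mult.assoc)
  finally show ?case
    by (simp add: insert.IH proj_idem)
qed simp

lemma corner_xpow: "corner Z e \<Longrightarrow> i \<in> Z \<Longrightarrow> e * xpow {i} (Suc N) = 0"
proof (induction rule: corner.induct)
  case (insert Z e j)
  show ?case
  proof (cases "i = j")
    case True
    then show ?thesis
      by (simp add: mult.assoc proj_xpow)
  next
    case False
    have *: "proj j * xpow {i} (Suc N) = xpow {i} (Suc N) * proj j"
      using False unfolding xpow_def by (intro proj_jmono_commute) simp
    have "e * proj j * xpow {i} (Suc N) = e * xpow {i} (Suc N) * proj j"
      by (simp only: mult.assoc *)
    then show ?thesis
      using False insert by simp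
  qed
qed simp

lemma corner_ypow: "corner Z e \<Longrightarrow> i \<in> Z \<Longrightarrow> ypow {i} (Suc N) * e = 0"
proof (induction rule: corner.induct)
  case (insert Z e j)
  show ?case
  proof (cases "i = j")
    case True
    then show ?thesis
      using insert by (simp add: corner_proj_commute) (simp add: mult.assoc[symmetric] ypow_proj)
  next
    case False
    then show ?thesis
      using insert by (simp add: mult.assoc[symmetric])
  qed
qed simp

lemma corner_in_tors: "corner Z e \<Longrightarrow> e \<in> tors Z"
  unfolding tors_def xtors_def by (auto intro!: exI[of _ "Suc 0"] simp: corner_xpow)

text \<open>Together with \<open>corner_in_tors\<close> this says that \<open>tors Z\<close> is the
  two-sided ideal generated by \<open>e\<close>, so any property that defines an ideal need only be
  checked at \<open>e\<close>.\<close>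

lemma corner_generates:
  assumes "corner Z e" "tideal J" "(e :: ('n::finite, 'k::field) jac) \<in> J"
  shows "tors Z \<subseteq> J"
proof -
  \<comment> \<open>The form that survives induction: factors are stripped from \<open>e\<close>
    until it is 1. Since \<open>b * c * e\<close> is torsion at \<open>j\<close>, it equals its
    product with some \<open>1 - x_j^N y_j^N\<close>, a sum of diagonal matrix units, and each of
    these brings back the missing factor \<open>proj j\<close>.\<close>
  have "b \<in> J" if "b \<in> tors Z" "\<And>c. b * c * e \<in> J" for b
    using assms(1) that
  proof (induction arbitrary: b rule: corner.induct)
    case empty
    then show ?case
      using empty(2)[of 1] by simp
  next
    case (insert Z e j)
    show ?case
    proof (rule insert.IH)
      show "b \<in> tors Z"
        using insert.prems(1) by (simp add: tors_def)
      fix c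
      have "b \<in> xtors {j}"
        using insert.prems(1) by (simp add: tors_def)
      then have "b * c * e \<in> xtors {j}"
        by (intro tideal_mult_right[OF xtors_tideal])
      then obtain N where "b * c * e * xpow {j} N = 0"
        by (auto simp: xtors_def)
      then have "b * c * e = b * c * e * (1 - xpow {j} N * ypow {j} N)"
        by (simp add: right_diff_distrib mult.assoc[symmetric])
      also have "\<dots> = (\<Sum>k<N. b * (c * xpow {j} k) * (e * proj j) * ypow {j} k)"
        unfolding one_minus_xpow_ypow sum_distrib_left
      proof (rule sum.cong[OF refl])
        fix k
        have e: "e * xpow {j} k = xpow {j} k * e"
          using insert.hyps by (intro corner_xpow_commute) auto
        have "b * c * e * (xpow {j} k * proj j * ypow {j} k) = b * c * (e * xpow {j} k) * proj j * ypow {j} k"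
          by (simp only: mult.assoc)
        also have "\<dots> = b * (c * xpow {j} k) * (e * proj j) * ypow {j} k"
          unfolding e by (simp only: mult.assoc)
        finally show "b * c * e * (xpow {j} k * proj j * ypow {j} k) = b * (c * xpow {j} k) * (e * proj j) * ypow {j} k" .
      qed
      also have "\<dots> \<in> J"
        by (intro tideal_sum[OF assms(2)] tideal_mult_right[OF assms(2), of "_ * (e * proj j)"] insert.prems(2))
      finally show "b * c * e \<in> J" .
    qed
  qed
  then show ?thesis
    using tideal_mult_left[OF assms(2,3)] by blast
qed

section \<open>Idempotent ideals\<close>

text \<open>An arbitrary numbering of the indices: the monomial order on exponents needs linearly
  ordered variables, and \<open>'n\<close> carries no order.\<close>

definition idx :: "'n::finite \<Rightarrow> nat" where
  "idx = (SOME f. inj f)"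

lemma inj_idx: "inj (idx :: 'n::finite \<Rightarrow> nat)"
proof -
  have "\<exists>f :: 'n \<Rightarrow> nat. inj f"
    using finite_imp_inj_to_nat_seg[of "UNIV :: 'n set"] by auto
  then show ?thesis
    unfolding idx_def by (rule someI_ex)
qed

definition exps_on :: "'n::finite set \<Rightarrow> (nat \<Rightarrow>\<^sub>0 nat) set" where
  "exps_on W = {\<alpha>. keys \<alpha> \<subseteq> idx ` W}"

lemma monotone_subsequence_nat:
  fixes s :: "nat \<Rightarrow> nat"
  shows "\<exists>r. strict_mono (r :: nat \<Rightarrow> nat) \<and> (\<forall>i j. i \<le> j \<longrightarrow> s (r i) \<le> s (r j))"
proof -
  obtain g where g: "strict_mono g" "monoseq (\<lambda>n. s (g n))"
    using seq_monosub by blast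
  \<comment> \<open>From an index where the subsequence attains its minimum, even a decreasing
    subsequence is constant.\<close>
  obtain n where n: "\<And>m. s (g n) \<le> s (g m)"
    using ex_has_least_nat[of "\<lambda>_. True" _ "\<lambda>n. s (g n)"] by auto
  have "s (g (i + n)) \<le> s (g (j + n))" if "i \<le> j" for i j
    using g(2) unfolding monoseq_def
  proof
    assume "\<forall>m. \<forall>n\<ge>m. s (g n) \<le> s (g m)"
    then have "s (g (i + n)) \<le> s (g n)"
      by simp
    then show ?thesis
      using n[of "j + n"] by simp
  qed (use that in simp)
  moreover have "strict_mono (\<lambda>i. g (i + n))"
    using g(1) by (simp add: strict_mono_def)
  ultimately show ?thesis
    by blast
qed

text \<open>Subsequences are refined one coordinate at a time; monotonicity in the earlier
  coordinates is inherited.\<close>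

lemma dickson_subsequence:
  fixes s :: "nat \<Rightarrow> nat \<Rightarrow>\<^sub>0 nat"
  assumes "finite K"
  shows "\<exists>r :: nat \<Rightarrow> nat. strict_mono r \<and> (\<forall>i j. i \<le> j \<longrightarrow> (\<forall>k\<in>K. lookup (s (r i)) k \<le> lookup (s (r j)) k))"
  using assms
proof (induction K rule: finite_induct)
  case empty
  show ?case
    by (intro exI[of _ id]) (simp add: strict_mono_def)
next
  case (insert k K)
  then obtain r :: "nat \<Rightarrow> nat" where r: "strict_mono r"
      "\<forall>i j. i \<le> j \<longrightarrow> (\<forall>k\<in>K. lookup (s (r i)) k \<le> lookup (s (r j)) k)"
    by (elim exE conjE)
  obtain g :: "nat \<Rightarrow> nat" where g: "strict_mono g"
      "\<forall>i j. i \<le> j \<longrightarrow> lookup (s (r (g i))) k \<le> lookup (s (r (g j))) k"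
    using monotone_subsequence_nat[of "\<lambda>n. lookup (s (r n)) k"] by (elim exE conjE)
  have "strict_mono (\<lambda>i. r (g i))"
    using r(1) g(1) by (simp add: strict_mono_def)
  moreover have "lookup (s (r (g i))) l \<le> lookup (s (r (g j))) l" if "i \<le> j" "l \<in> insert k K" for i j l
    using that g(2) r(2) strict_mono_less_eq[OF g(1), of i j] by auto
  ultimately show ?case
    by (intro exI[of _ "\<lambda>i. r (g i)"]) blast
qed

interpretation exponents: dickson_monoid "exps_on W" for W :: "'n::finite set"
proof
  show "0 \<in> exps_on W"
    by (simp add: exps_on_def)
  show "a + b \<in> exps_on W" if "a \<in> exps_on W" "b \<in> exps_on W" for a b
    using that keys_add[of a b] by (auto simp: exps_on_def)
  show "0 \<le> a" for a :: "nat \<Rightarrow>\<^sub>0 nat"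
  proof (cases "a = 0")
    case False
    then obtain k where "lookup a k \<noteq> 0"
      using poly_mapping_eqI[of a 0] by auto
    \<comment> \<open>In the lexicographic order the first nonzero exponent decides the comparison
      with 0.\<close>
    define l where "l = (LEAST k. lookup a k \<noteq> 0)"
    have "lookup a l \<noteq> 0"
      unfolding l_def by (rule LeastI) fact
    moreover have "lookup a k = 0" if "k < l" for k
      using not_less_Least that unfolding l_def by blast
    ultimately have "less_fun (lookup 0) (lookup a)"
      unfolding less_fun_def by (intro exI[of _ l]) simp
    then show ?thesis
      by (simp add: less_eq_poly_mapping.rep_eq)
  qed simp
  show "\<exists>i j. i < j \<and> (\<exists>c\<in>exps_on W. s j = s i + c)" if "\<And>n. s n \<in> exps_on W" for s :: "nat \<Rightarrow> nat \<Rightarrow>\<^sub>0 nat"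
  proof -
    obtain r :: "nat \<Rightarrow> nat" where r: "strict_mono r"
        "\<forall>i j. i \<le> j \<longrightarrow> (\<forall>k\<in>idx ` W. lookup (s (r i)) k \<le> lookup (s (r j)) k)"
      using dickson_subsequence[OF finite_imageI[OF finite[of W]], of idx s] by (elim exE conjE)
    have le: "lookup (s (r 0)) k \<le> lookup (s (r 1)) k" for k
    proof (cases "k \<in> idx ` W")
      case False
      then have "k \<notin> keys (s (r 0))"
        using that[of "r 0"] by (auto simp: exps_on_def)
      then show ?thesis
        by (simp add: in_keys_iff)
    qed (use r(2) in auto)
    have "keys (s (r 1) - s (r 0)) \<subseteq> keys (s (r 1))"
      by (auto simp: in_keys_iff lookup_minus)
    then have "s (r 1) - s (r 0) \<in> exps_on W"
      using that[of "r 1"] by (auto simp: exps_on_def)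
    moreover have "s (r 1) = s (r 0) + (s (r 1) - s (r 0))"
      using le by (intro poly_mapping_eqI) (simp add: lookup_add lookup_minus)
    moreover have "r 0 < r 1"
      using r(1) by (simp add: strict_mono_def)
    ultimately show ?thesis
      by blast
  qed
qed

abbreviation polys_on :: "'n::finite set \<Rightarrow> ((nat \<Rightarrow>\<^sub>0 nat) \<Rightarrow>\<^sub>0 'k::field) set" where
  "polys_on W \<equiv> dickson_monoid.polys (exps_on W)"

section \<open>Commutative polynomials inside the algebra\<close>

definition emb :: "(nat \<Rightarrow>\<^sub>0 nat) \<Rightarrow> 'n::finite jmon" where
  "emb \<alpha> = Mon (\<lambda>i. (lookup \<alpha> (idx i), 0))"

lemma emb_zero: "emb 0 = 0"
  by (simp add: emb_def zero_jmon_def)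

lemma emb_add: "emb (\<alpha> + \<beta>) = emb \<alpha> + emb \<beta>"
  by (simp add: emb_def plus_jmon_def mmul_def bmul_def lookup_add)

text \<open>Restricted to \<open>exps_on W\<close> because \<open>emb\<close> forgets the exponents
  at numbers that index no element of \<open>'n\<close>.\<close>

lemma inj_on_emb: "inj_on (emb :: _ \<Rightarrow> 'n::finite jmon) (exps_on (W :: 'n set))"
proof (rule inj_onI)
  fix \<alpha> \<beta> assume *: "\<alpha> \<in> exps_on W" "\<beta> \<in> exps_on W" "(emb \<alpha> :: 'n jmon) = emb \<beta>"
  have "lookup \<alpha> (idx i) = lookup \<beta> (idx i)" for i :: 'n
    using *(3) by (auto simp: emb_def fun_eq_iff)
  moreover have "k \<notin> keys \<alpha>" "k \<notin> keys \<beta>" if "k \<notin> range (idx :: 'n \<Rightarrow> nat)" for k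
    using *(1,2) that by (auto simp: exps_on_def)
  ultimately show "\<alpha> = \<beta>"
    by (intro poly_mapping_eqI) (metis in_keys_iff rangeE)
qed

definition expo :: "'n::finite set \<Rightarrow> ('n \<Rightarrow> nat) \<Rightarrow> nat \<Rightarrow>\<^sub>0 nat" where
  "expo W d = (\<Sum>i\<in>W. Poly_Mapping.single (idx i) (d i))"

lemma lookup_expo: "lookup (expo W d) (idx j) = (if j \<in> W then d j else 0)"
proof -
  have "lookup (expo W d) (idx j) = (\<Sum>i\<in>W. if i = j then d i else 0)"
    unfolding expo_def lookup_sum lookup_single when_def by (simp add: inj_eq[OF inj_idx])
  then show ?thesis
    by simp
qed

lemma expo_in: "expo W d \<in> exps_on W"
proof -
  have "keys (expo W d) \<subseteq> (\<Union>i\<in>W. keys (Poly_Mapping.single (idx i) (d i)))"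
    unfolding expo_def by (rule keys_sum)
  then show ?thesis
    by (auto simp: exps_on_def split: if_splits)
qed

definition iota :: "((nat \<Rightarrow>\<^sub>0 nat) \<Rightarrow>\<^sub>0 'k::field) \<Rightarrow> ('n::finite, 'k) jac" where
  "iota p = (\<Sum>\<alpha>\<in>keys p. Poly_Mapping.single (emb \<alpha>) (lookup p \<alpha>))"

lemma iota_zero [simp]: "iota 0 = 0"
  by (simp add: iota_def)

lemma iota_single: "iota (Poly_Mapping.single \<alpha> k) = Poly_Mapping.single (emb \<alpha>) k"
  by (simp add: iota_def)

lemma iota_add: "iota (p + q) = iota p + iota q"
  unfolding iota_def by (rule setsum_keys_plus_distrib) (simp_all add: single_add)

lemma iota_mult: "iota (p * q) = iota p * iota q"
proof (induction p rule: poly_mapping_add_induct)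
  case (single \<alpha> k)
  show ?case
    by (induction q rule: poly_mapping_add_induct)
      (simp_all add: mult_single iota_single emb_add distrib_left iota_add)
qed (simp_all add: distrib_right iota_add)

lemma iota_commute: "iota p * iota q = iota q * iota p"
  by (metis iota_mult mult.commute)

lemma iota_minus: "iota (p - q) = iota p - iota q"
  by (simp add: eq_diff_eq iota_add[symmetric])

lemma iota_inj:
  assumes "p \<in> polys_on (W :: 'n set)" "(iota p :: ('n::finite, 'k::field) jac) = 0"
  shows "p = 0"
proof (rule poly_mapping_eqI)
  fix \<alpha>
  have sub: "keys p \<subseteq> exps_on W"
    using assms(1) by (simp add: exponents.polys_def)
  show "lookup p \<alpha> = lookup 0 \<alpha>"
  proof (cases "\<alpha> \<in> keys p")
    case True
    have inj: "(emb \<beta> :: 'n jmon) = emb \<alpha> \<longleftrightarrow> \<beta> = \<alpha>" if "\<beta> \<in> keys p" for \<beta>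
      using inj_on_eq_iff[OF inj_on_subset[OF inj_on_emb sub] that True] .
    have "0 = lookup (iota p :: ('n, 'k) jac) (emb \<alpha>)"
      by (simp add: assms(2))
    also have "\<dots> = (\<Sum>\<beta>\<in>keys p. if \<beta> = \<alpha> then lookup p \<beta> else 0)"
      unfolding iota_def lookup_sum lookup_single when_def
      using inj by (intro sum.cong) auto
    also have "\<dots> = lookup p \<alpha>"
      using True by simp
    finally show ?thesis
      by simp
  qed (simp add: in_keys_iff)
qed

definition xmon :: "'n::finite set \<Rightarrow> nat \<Rightarrow> (nat \<Rightarrow>\<^sub>0 nat) \<Rightarrow>\<^sub>0 'k::field" where
  "xmon W N = Poly_Mapping.single (expo W (\<lambda>_. N)) 1"

lemma xmon_in: "xmon W N \<in> polys_on W"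
  unfolding xmon_def by (rule exponents.polys_single[OF expo_in])

lemma iota_expo: "iota (Poly_Mapping.single (expo W d) 1) = jmono (\<lambda>i. if i \<in> W then (d i, 0) else (0, 0))"
  by (auto simp: iota_single jmono_def emb_def lookup_expo intro!: arg_cong[of _ _ Mon] arg_cong2[of _ _ _ _ Poly_Mapping.single])

lemma iota_xmon: "iota (xmon W N) = xpow W N"
  unfolding xmon_def xpow_def iota_expo ..

lemma iota_one: "iota 1 = 1"
  by (metis emb_zero iota_single single_one)

lemma iota_xmon_power: "iota (xmon W 1 ^ s) = xpow W s"
proof (induction s)
  case (Suc s)
  show ?case
    unfolding power_Suc iota_mult iota_xmon Suc.IH xpow_add[symmetric] by simp
qed (simp add: iota_one)

definition trivial_on :: "'n set \<Rightarrow> ('n, 'k::field) jac \<Rightarrow> bool" where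
  "trivial_on Z a \<longleftrightarrow> (\<forall>k\<in>keys a. \<forall>i\<in>Z. exps k i = (0, 0))"

lemma iota_trivial:
  assumes "p \<in> polys_on (- Z)"
  shows "trivial_on Z (iota p)"
proof -
  have "keys (iota p) \<subseteq> emb ` keys p"
    using keys_sum[of "\<lambda>\<alpha>. Poly_Mapping.single (emb \<alpha>) (lookup p \<alpha>)" "keys p"]
    by (auto simp: iota_def split: if_splits)
  moreover have "lookup \<alpha> (idx i) = 0" if "\<alpha> \<in> keys p" "i \<in> Z" for \<alpha> i
  proof -
    have "keys p \<subseteq> exps_on (- Z)"
      using assms by (simp add: exponents.polys_def)
    then have "keys \<alpha> \<subseteq> idx ` (- Z)"
      using that(1) by (auto simp: exps_on_def)
    moreover have "idx i \<notin> idx ` (- Z)"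
      using that(2) inj_image_mem_iff[OF inj_idx, of i "- Z"] by simp
    ultimately show ?thesis
      by (auto simp: in_keys_iff)
  qed
  ultimately show ?thesis
    by (fastforce simp: trivial_on_def emb_def)
qed

text \<open>\<open>proj j * a\<close> is \<open>a\<close> minus \<open>x_j y_j a\<close>. Monomials
  of the first term have component \<open>(0, 0)\<close> at \<open>j\<close>, those of the second
  \<open>(1, 1)\<close>, so the terms cannot cancel unless \<open>a = 0\<close>.\<close>

lemma corner_no_kernel:
  assumes "corner Z e" "trivial_on Z a" "e * a = 0"
  shows "a = 0"
  using assms
proof (induction arbitrary: a rule: corner.induct)
  case (insert Z e j)
  define s :: "'a mon" where "s = (\<lambda>i. if i = j then (1, 1) else (0, 0))"
  have xy: "xpow {j} 1 * ypow {j} 1 = jmono s"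
    by (auto simp: xpow_def ypow_def jmono_mult s_def mmul_def bmul_def intro!: arg_cong[of _ _ jmono])
  have proj: "proj j * a = a - jmono s * a"
    unfolding proj_def left_diff_distrib xy by simp
  have keys: "exps k j = (1, 1) \<and> (\<forall>i\<in>Z. exps k i = (0, 0))" if k: "k \<in> keys (jmono s * a)" for k
  proof -
    obtain k' where "k' \<in> keys a" "k = Mon s + k'"
      using keys_mult[of "jmono s" a] k by (auto simp: jmono_def)
    then show ?thesis
      using insert.prems(1) insert.hyps(2) by (auto simp: trivial_on_def plus_jmon_def mmul_def s_def)
  qed
  have "keys (proj j * a) \<subseteq> keys a \<union> keys (jmono s * a)"
    unfolding proj by (rule keys_diff)
  then have "trivial_on Z (proj j * a)"
    using keys insert.prems(1) unfolding trivial_on_def by blast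
  moreover have "e * (proj j * a) = 0"
    using insert.prems(2) by (simp add: mult.assoc)
  ultimately have "proj j * a = 0"
    by (rule insert.IH)
  then have a: "a = jmono s * a"
    using proj by simp
  have "keys a = {}"
  proof (rule equals0I)
    fix k assume k: "k \<in> keys a"
    then have "exps k j = (1, 1)"
      using keys a by simp
    moreover have "exps k j = (0, 0)"
      using insert.prems(1) k by (simp add: trivial_on_def)
    ultimately show False
      by simp
  qed
  then show ?case
    by simp
qed simp

lemma corner_iota_inj:
  assumes "corner (- W) e" "p \<in> polys_on W" "e * iota p = 0"
  shows "p = 0"
  using corner_no_kernel[OF assms(1) _ assms(3)] iota_trivial[of p "- W"] iota_inj assms(2) by simp

lemma corner_trivial_commute:
  assumes "corner Z e" "trivial_on Z a"
  shows "e * a = a * e"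
proof -
  have "e * Poly_Mapping.single k (lookup a k) = Poly_Mapping.single k (lookup a k) * e" if "k \<in> keys a" for k
  proof -
    have "e * jmono (exps k) = jmono (exps k) * e"
      using assms that by (intro corner_jmono_commute[OF assms(1)]) (auto simp: trivial_on_def)
    moreover have "e * (Poly_Mapping.single 0 c * b) = Poly_Mapping.single 0 c * (e * b)" for c b
      by (simp only: mult.assoc[symmetric] scalar_commute[of c e])
    ultimately have "e * (Poly_Mapping.single 0 c * jmono (exps k)) = Poly_Mapping.single 0 c * jmono (exps k) * e" for c
      by (simp add: mult.assoc)
    then show ?thesis
      by (simp add: single_eq_scalar_jmono[symmetric])
  qed
  then have "e * (\<Sum>k\<in>keys a. Poly_Mapping.single k (lookup a k)) = (\<Sum>k\<in>keys a. Poly_Mapping.single k (lookup a k)) * e"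
    unfolding sum_distrib_left sum_distrib_right by (intro sum.cong) auto
  then show ?thesis
    by (simp only: poly_mapping_expand)
qed

lemma sandwich_shift:
  assumes "c * xpow W N = e * iota p"
  shows "c * xpow W (N + M) = e * iota (p * xmon W M)"
  using assms by (simp add: xpow_add iota_mult iota_xmon mult.assoc[symmetric])

text \<open>Sandwiching with \<open>e\<close> removes all monomials that involve an index outside
  \<open>W\<close>; the power of the \<open>x_i\<close> then absorbs the remaining
  \<open>y_i\<close>.\<close>

lemma corner_sandwich:
  assumes e: "corner (- W) (e :: ('n::finite, 'k::field) jac)"
  shows "\<exists>N. \<exists>p\<in>polys_on W. e * a * e * xpow W N = e * iota p"
proof (induction a rule: jac_induct)
  case (jmono m)
  show ?case
  proof (cases "\<forall>i\<in>- W. m i = (0, 0)")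
    case True
    define N where "N = (\<Sum>i\<in>UNIV. snd (m i))"
    have N: "snd (m i) \<le> N" for i
      using member_le_sum[of i UNIV "\<lambda>i. snd (m i)"] by (simp add: N_def)
    define d where "d = (\<lambda>i. fst (m i) + N - snd (m i))"
    have "bmul (m i) (if i \<in> W then (N, 0) else (0, 0)) = (if i \<in> W then (d i, 0) else (0, 0))" for i
      using N[of i] True by (auto simp: bmul_def d_def)
    then have "jmono m * xpow W N = (iota (Poly_Mapping.single (expo W d) 1) :: ('n, 'k) jac)"
      unfolding iota_expo xpow_def jmono_mult mmul_def by simp
    moreover have "e * jmono m * e = e * jmono m"
      using True corner_jmono_commute[OF e, of m] corner_idem[OF e] by (simp add: mult.assoc[symmetric])
        (metis ComplI corner_jmono_commute e mult.assoc)
    ultimately have "e * jmono m * e * xpow W N = e * iota (Poly_Mapping.single (expo W d) 1)"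
      by (simp add: mult.assoc)
    then show ?thesis
      using exponents.polys_single[OF expo_in] by blast
  next
    case False
    then obtain i where i: "i \<in> - W" "m i \<noteq> (0, 0)"
      by blast
    \<comment> \<open>Either \<open>m\<close> can be written with \<open>x_i\<close> in front,
      killed by \<open>e\<close> from the left, or with \<open>y_i\<close> at the end, killed by
      \<open>e\<close> from the right.\<close>
    have "e * jmono m * e = 0"
    proof (cases "fst (m i) = 0")
      case False
      have "bmul (if l \<in> {i} then (Suc 0, 0) else (0, 0)) ((m(i := (fst (m i) - 1, snd (m i)))) l) = m l" for l
        using False by (auto simp: bmul_def prod_eq_iff)
      then have "(jmono m :: ('n, 'k) jac) = xpow {i} (Suc 0) * jmono (m(i := (fst (m i) - 1, snd (m i))))"
        unfolding xpow_def jmono_mult mmul_def by simp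
      then show ?thesis
        using corner_xpow[OF e i(1), of 0] by (simp add: mult.assoc[symmetric])
    next
      case True
      then have "snd (m i) \<noteq> 0"
        using i(2) by (auto simp: prod_eq_iff)
      then have "bmul ((m(i := (fst (m i), snd (m i) - 1))) l) (if l \<in> {i} then (0, Suc 0) else (0, 0)) = m l" for l
        by (auto simp: bmul_def prod_eq_iff)
      then have "(jmono m :: ('n, 'k) jac) = jmono (m(i := (fst (m i), snd (m i) - 1))) * ypow {i} (Suc 0)"
        unfolding ypow_def jmono_mult mmul_def by simp
      then show ?thesis
        using corner_ypow[OF e i(1), of 0] by (simp add: mult.assoc)
    qed
    then show ?thesis
      by (intro exI[of _ 0] bexI[of _ 0]) (simp_all add: exponents.polys_zero)
  qed
next
  case (scalar k a)
  then obtain N p where p: "p \<in> polys_on W" "e * a * e * xpow W N = e * iota p"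
    by blast
  let ?k = "Poly_Mapping.single 0 k :: ('n, 'k) jac"
  have comm: "e * (?k * b) = ?k * (e * b)" for b
    by (simp only: mult.assoc[symmetric] scalar_commute[of k e])
  have "e * (?k * a) * e * xpow W N = ?k * (e * a * e * xpow W N)"
    by (simp only: comm mult.assoc)
  also have "\<dots> = e * iota (Poly_Mapping.single 0 k * p)"
    unfolding p(2) by (simp only: comm iota_mult iota_single emb_zero)
  finally show ?case
    using exponents.polys_mult[OF exponents.polys_single[OF exponents.zero_mem] p(1)] by blast
next
  case (add a b)
  then obtain M N p q where p: "p \<in> polys_on W" "e * a * e * xpow W M = e * iota p"
    and q: "q \<in> polys_on W" "e * b * e * xpow W N = e * iota q"
    by blast
  have "e * (a + b) * e * xpow W (M + N) = e * a * e * xpow W (M + N) + e * b * e * xpow W (N + M)"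
    by (simp add: distrib_left distrib_right add.commute)
  also have "\<dots> = e * iota (p * xmon W N + q * xmon W M)"
    by (simp only: sandwich_shift[OF p(2)] sandwich_shift[OF q(2)] iota_add distrib_left)
  finally show ?case
    using exponents.polys_add exponents.polys_mult xmon_in p(1) q(1) by blast
qed

text \<open>The inclusion of \<open>I\<close> in \<open>I^2\<close>, expressed by the universal
  property of the product ideal; the reverse inclusion holds for every ideal.\<close>

definition idempotent :: "'a::ring_1 set \<Rightarrow> bool" where
  "idempotent I \<longleftrightarrow> tideal I \<and> (\<forall>L. tideal L \<longrightarrow> (\<forall>a\<in>I. \<forall>b\<in>I. a * b \<in> L) \<longrightarrow> I \<subseteq> L)"

lemma add_span_mult_right: "a \<in> add_span S \<Longrightarrow> (\<And>b. b \<in> S \<Longrightarrow> b * r \<in> S) \<Longrightarrow> a * r \<in> add_span S" for a :: "'a::semiring_0"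
  by (induction rule: add_span.induct) (auto simp: distrib_right intro: add_span.intros)

text \<open>Applied in contrapositive form: if \<open>e\<close> is not in \<open>I\<close>,
  everything in \<open>I\<close> and \<open>tors (- W)\<close> is killed by a power of the product
  of the \<open>x_i\<close> with \<open>i\<close> in \<open>W\<close>.\<close>

lemma corner_in_idempotent:
  assumes idem: "idempotent (I :: ('n::finite, 'k::field) jac set)" and e: "corner (- W) e"
    and a: "a \<in> I" "a \<in> tors (- W)" "a \<notin> xtors W"
  shows "e \<in> I"
proof -
  have I: "tideal I"
    using idem by (simp add: idempotent_def)
  define J where "J = {p \<in> polys_on W. e * iota p \<in> I}"
  have J: "dickson_monoid.polys_ideal (exps_on W) J"
    unfolding exponents.polys_ideal_def
  proof (intro conjI ballI)
    fix r p :: "(nat \<Rightarrow>\<^sub>0 nat) \<Rightarrow>\<^sub>0 'k"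
    assume r: "r \<in> polys_on W" and p: "p \<in> J"
    have "e * iota (r * p) = e * iota p * iota r"
      by (simp only: iota_mult iota_commute[of r] mult.assoc)
    then show "r * p \<in> J"
      using exponents.polys_mult[OF r] p tideal_mult_right[OF I] by (simp add: J_def)
  qed (auto simp: J_def exponents.polys_zero exponents.polys_add iota_add distrib_left tideal_zero[OF I] tideal_add[OF I])
  have sandwich: "\<exists>N. \<exists>p\<in>J. e * c * e * xpow W N = e * iota p" if "c \<in> I" for c
  proof -
    obtain N p where "p \<in> polys_on W" "e * c * e * xpow W N = e * iota p"
      using corner_sandwich[OF e] by blast
    moreover have "e * c * e * xpow W N \<in> I"
      using that by (intro tideal_mult_left[OF I] tideal_mult_right[OF I])
    ultimately show ?thesis
      by (auto simp: J_def)
  qed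
  have "\<exists>p\<in>J. p \<noteq> 0"
  proof (rule ccontr)
    assume neg: "\<not> ?thesis"
    \<comment> \<open>If \<open>J\<close> were zero, all sandwiches of elements of \<open>I\<close>
      would be torsion. The outer factors \<open>e\<close> are then exchanged, first the left and
      then the right, for local units of \<open>a\<close>, so that \<open>a\<close> itself becomes
      torsion.\<close>
    have corner: "e * c * e \<in> xtors W" if "c \<in> I" for c
      using sandwich[OF that] neg by (fastforce simp: xtors_def)
    obtain u u' where u: "u \<in> tors (- W)" "a * u = a" and u': "u' \<in> tors (- W)" "u' * a = a"
      using tors_unit_right[OF a(2)] tors_unit_left[OF a(2)] by blast
    have "tideal {w. \<forall>r s. w * r * a * s * e \<in> xtors W}"
    proof (rule tidealI, goal_cases)
      case 1
      show ?case
        using tideal_zero[OF xtors_tideal] by simp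
    next
      case (2 b c)
      then show ?case
        by (auto simp: distrib_right intro!: tideal_add[OF xtors_tideal])
    next
      case (3 r b)
      then show ?case
        using tideal_mult_left[OF xtors_tideal, of _ W r] by (simp add: mult.assoc)
    next
      case (4 r b)
      then show ?case
        by (simp add: mult.assoc) (metis mult.assoc)
    qed
    moreover have "e * r * a * s * e \<in> xtors W" for r s
      using corner[of "r * a * s"] tideal_mult_left[OF I] tideal_mult_right[OF I] a(1) by (simp add: mult.assoc)
    ultimately have "tors (- W) \<subseteq> {w. \<forall>r s. w * r * a * s * e \<in> xtors W}"
      by (intro corner_generates[OF e]) auto
    then have "u' * 1 * a * s * e \<in> xtors W" for s
      using u'(1) by blast
    then have 1: "a * s * e \<in> xtors W" for s
      by (simp add: u'(2))
    have "tideal {w. \<forall>s. a * s * w \<in> xtors W}"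
    proof (rule tidealI, goal_cases)
      case 1
      show ?case
        using tideal_zero[OF xtors_tideal] by simp
    next
      case (2 b c)
      then show ?case
        by (auto simp: distrib_left intro!: tideal_add[OF xtors_tideal])
    next
      case (3 r b)
      then show ?case
        by (simp add: mult.assoc) (metis mult.assoc)
    next
      case (4 r b)
      then show ?case
        using tideal_mult_right[OF xtors_tideal, of _ W r] by (simp add: mult.assoc[symmetric])
    qed
    with 1 have "tors (- W) \<subseteq> {w. \<forall>s. a * s * w \<in> xtors W}"
      by (intro corner_generates[OF e]) auto
    then have "a * 1 * u \<in> xtors W"
      using u(1) by blast
    then show False
      using a(3) u(2) by simp
  qed
  then obtain b where b: "b \<in> J" "b \<noteq> 0"
    by blast
  let ?P = "{c * d | c d. c \<in> J \<and> d \<in> J}"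
  \<comment> \<open>The elements whose sandwich lands in \<open>J^2\<close> once the
    \<open>y_i\<close> are absorbed. \<open>Q\<close> is closed under addition but need not be an
    ideal.\<close>
  define Q where "Q = {c. \<exists>N. \<exists>r\<in>add_span ?P. e * c * e * xpow W N = e * iota r}"
  have P_mult: "y * r \<in> ?P" if "y \<in> ?P" "r \<in> polys_on W" for y r
  proof -
    obtain c d where cd: "y = c * d" "c \<in> J" "d \<in> J"
      using \<open>y \<in> ?P\<close> by blast
    have "r * d \<in> J"
      using J cd(3) that(2) by (simp add: exponents.polys_ideal_def)
    moreover have "y * r = c * (r * d)"
      by (simp add: cd(1) ac_simps)
    ultimately show ?thesis
      using cd(2) by blast
  qed
  have Q0: "0 \<in> Q"
    unfolding Q_def by (intro CollectI exI[of _ 0] bexI[of _ 0]) (simp_all add: add_span.zero)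
  have Qadd: "c + d \<in> Q" if "c \<in> Q" "d \<in> Q" for c d
  proof -
    obtain M N r s where r: "r \<in> add_span ?P" "e * c * e * xpow W M = e * iota r"
      and s: "s \<in> add_span ?P" "e * d * e * xpow W N = e * iota s"
      using \<open>c \<in> Q\<close> \<open>d \<in> Q\<close> unfolding Q_def by blast
    have "e * (c + d) * e * xpow W (M + N) = e * c * e * xpow W (M + N) + e * d * e * xpow W (N + M)"
      by (simp add: distrib_left distrib_right add.commute)
    also have "\<dots> = e * iota (r * xmon W N + s * xmon W M)"
      by (simp only: sandwich_shift[OF r(2)] sandwich_shift[OF s(2)] iota_add distrib_left)
    finally show ?thesis
      unfolding Q_def using add_span_add add_span_mult_right[OF r(1) P_mult[OF _ xmon_in]] add_span_mult_right[OF s(1) P_mult[OF _ xmon_in]]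
      by blast
  qed
  \<comment> \<open>With \<open>e\<close> in the middle the sandwich is the product of the two
    sandwiches. The \<open>y_i\<close> of the right one are absorbed first; the remaining power of
    the \<open>x_i\<close> commutes with the polynomial \<open>q\<close> and serves the left
    one.\<close>
  have corner_prod: "c * e * d \<in> Q" if "c \<in> I" "d \<in> I" for c d
  proof -
    obtain N p where p: "p \<in> J" "e * c * e * xpow W N = e * iota p"
      using sandwich[OF \<open>c \<in> I\<close>] by blast
    obtain M q where q: "q \<in> J" "e * d * e * xpow W M = e * iota q"
      using sandwich[OF \<open>d \<in> I\<close>] by blast
    have ee: "e * e = e" "\<And>z. e * (e * z) = e * z"
      using corner_idem[OF e] by (simp_all add: mult.assoc[symmetric])
    have "e * (c * e * d) * e * xpow W (M + N) = e * c * (e * d * e * xpow W M) * xpow W N"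
      by (simp add: mult.assoc xpow_add)
    also have "\<dots> = e * c * e * (iota q * iota (xmon W N))"
      unfolding q(2) iota_xmon by (simp add: mult.assoc)
    also have "\<dots> = (e * c * e * xpow W N) * iota q"
      unfolding iota_commute[of q] by (simp only: iota_xmon mult.assoc)
    also have "\<dots> = e * iota (p * q)"
      unfolding p(2) by (simp only: iota_mult mult.assoc)
    finally show ?thesis
      unfolding Q_def using add_span_superset[of "p * q" ?P] p(1) q(1) by blast
  qed
  have prod: "c * d \<in> Q" if "c \<in> I" "d \<in> I" for c d
  proof -
    \<comment> \<open>The extra \<open>e\<close> on the left puts \<open>e * c\<close> into
      \<open>tors (- W)\<close>, where it has a right local unit \<open>u\<close>. As
      \<open>u\<close> lies in the ideal generated by \<open>e\<close>, \<open>corner_prod\<close>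
      applies to \<open>e * c * u * d\<close>.\<close>
    have ec: "e * c \<in> tors (- W)" "e * c \<in> I"
      using that by (auto intro: tideal_mult_right[OF tors_tideal corner_in_tors[OF e]] tideal_mult_left[OF I])
    obtain u where u: "u \<in> tors (- W)" "e * c * u = e * c"
      using tors_unit_right[OF ec(1)] by blast
    have "tideal {w. \<forall>r s. e * c * r * w * s * d \<in> Q}"
    proof (rule tidealI, goal_cases)
      case 1
      show ?case
        using Q0 by simp
    next
      case (2 a b)
      then show ?case
        using Qadd by (simp add: distrib_right distrib_left)
    next
      case (3 r b)
      then show ?case
        by (simp add: mult.assoc) (metis mult.assoc)
    next
      case (4 r b)
      then show ?case
        by (simp add: mult.assoc) (metis mult.assoc)
    qed
    moreover have "e * c * r * e * s * d \<in> Q" for r s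
      using corner_prod[of "e * c * r" "s * d"] tideal_mult_left[OF I that(2)] tideal_mult_right[OF I ec(2)]
      by (simp add: mult.assoc)
    ultimately have "tors (- W) \<subseteq> {w. \<forall>r s. e * c * r * w * s * d \<in> Q}"
      by (intro corner_generates[OF e]) auto
    then have "e * c * 1 * u * 1 * d \<in> Q"
      using u(1) by blast
    then have "e * c * d \<in> Q"
      by (simp add: u(2))
    then have "e * (c * d) \<in> Q"
      by (simp add: mult.assoc)
    moreover have "e * (e * (c * d)) = e * (c * d)"
      using corner_idem[OF e] by (simp add: mult.assoc[symmetric])
    ultimately show ?thesis
      by (simp add: Q_def)
  qed
  \<comment> \<open>The elements all of whose two-sided multiples lie in \<open>Q\<close> form an
    ideal, as idempotence of \<open>I\<close> requires.\<close>
  have "tideal {c. \<forall>r s. r * c * s \<in> Q}"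
  proof (rule tidealI, goal_cases)
    case 1
    show ?case
      using Q0 by simp
  next
    case (2 a b)
    then show ?case
      using Qadd by (simp add: distrib_right distrib_left)
  next
    case (3 r b)
    then show ?case
      by (simp add: mult.assoc[symmetric])
  next
    case (4 r b)
    then show ?case
      by (simp add: mult.assoc)
  qed
  moreover have "\<forall>r s. r * (c * d) * s \<in> Q" if "c \<in> I" "d \<in> I" for c d
    using prod[OF tideal_mult_left[OF I that(1)] tideal_mult_right[OF I that(2)]] by (simp add: mult.assoc)
  ultimately have IQ: "I \<subseteq> {c. \<forall>r s. r * c * s \<in> Q}"
    using idem by (simp add: idempotent_def)
  \<comment> \<open>Membership of \<open>e * iota p\<close> in \<open>Q\<close> gives an equation
    between \<open>e\<close> times two polynomials, from which \<open>e\<close> is cancelled by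
    \<open>corner_iota_inj\<close>.\<close>
  have "\<exists>s. xmon W 1 ^ s * p \<in> add_span ?P" if p: "p \<in> J" for p
  proof -
    have pW: "p \<in> polys_on W"
      using p by (simp add: J_def)
    have "1 * (e * iota p) * 1 \<in> Q"
      using IQ p unfolding J_def by blast
    then obtain N r where r: "r \<in> add_span ?P" "e * (e * iota p) * e * xpow W N = e * iota r"
      by (auto simp: Q_def)
    have rW: "r \<in> polys_on W"
      using r(1) by (induction rule: add_span.induct)
        (auto intro!: exponents.polys_zero exponents.polys_add exponents.polys_mult simp: J_def)
    have "e * iota p * e = e * iota p"
      using corner_idem[OF e] corner_trivial_commute[OF e iota_trivial[of p "- W"]] pW
      by (simp add: mult.assoc)
    then have "e * (e * iota p) * e * xpow W N = e * iota p * xpow W N"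
      using corner_idem[OF e] by (simp add: mult.assoc[symmetric])
    also have "\<dots> = e * iota (xmon W 1 ^ N * p)"
      by (simp only: iota_mult iota_xmon_power iota_xmon[symmetric] iota_commute[of p] mult.assoc)
    finally have "e * iota (xmon W 1 ^ N * p - r) = 0"
      using r(2) by (simp add: iota_minus right_diff_distrib)
    moreover have "xmon W 1 ^ N * p - r \<in> polys_on W"
    proof -
      have "xmon W 1 ^ N \<in> polys_on W"
        by (induction N) (auto intro: exponents.polys_one exponents.polys_mult xmon_in)
      then show ?thesis
        by (intro exponents.polys_minus exponents.polys_mult pW rW)
    qed
    ultimately have "xmon W 1 ^ N * p - r = 0"
      using corner_iota_inj[OF e] by blast
    then show ?thesis
      using r(1) by auto
  qed
  then obtain s where "xmon W 1 ^ s \<in> J"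
    using exponents.power_in_locally_idempotent_ideal[OF J b xmon_in] by blast
  then have "e * xpow W s \<in> I"
    unfolding J_def by (simp only: mem_Collect_eq iota_xmon_power)
  \<comment> \<open>The \<open>y_i\<close> with \<open>i\<close> in \<open>W\<close> commute with
    \<open>e\<close>, so the power of the \<open>x_i\<close> is cancelled from the left.\<close>
  then have "ypow W s * (e * xpow W s) \<in> I"
    by (rule tideal_mult_left[OF I])
  moreover have "ypow W s * (e * xpow W s) = e"
  proof -
    have "ypow W s * (e * xpow W s) = e * ypow W s * xpow W s"
      using corner_ypow_commute[OF e, of W s] by (simp add: mult.assoc[symmetric])
    then show ?thesis
      by (simp add: mult.assoc)
  qed
  ultimately show ?thesis
    by simp
qed

theorem idempotent_subset:
  assumes idem: "idempotent (I :: ('n::finite, 'k::field) jac set)" and J: "tideal J"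
    and tors: "\<And>Z. tors Z \<subseteq> I \<Longrightarrow> tors Z \<subseteq> J"
  shows "I \<subseteq> J"
proof -
  have I: "tideal I"
    using idem by (simp add: idempotent_def)
  \<comment> \<open>Torsion is required outside \<open>W\<close>: a smaller \<open>W\<close> is a
    stronger condition, and \<open>W = UNIV\<close> imposes none.\<close>
  have "I \<inter> tors (- W) \<subseteq> J" for W
  proof (induction "card W" arbitrary: W rule: less_induct)
    case less
    show ?case
    proof (cases "tors (- W) \<subseteq> I")
      case True
      then show ?thesis
        using tors by blast
    next
      case False
      have xtors: "a \<in> xtors W" if "a \<in> I" "a \<in> tors (- W)" for a
        using corner_exists[of "- W", where 'k = 'k] corner_in_idempotent[OF idem _ that]
          corner_generates[OF _ I] False by blast
      show ?thesis
      proof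
        fix a assume a: "a \<in> I \<inter> tors (- W)"
        then obtain N where "a * xpow W N = 0"
          using xtors by (auto simp: xtors_def)
        moreover have "b \<in> J" if "V \<subseteq> W" "b \<in> I" "b \<in> tors (- W)" "b * xpow V N = 0" for V b
          using finite[of V] that
        proof (induction V arbitrary: b rule: finite_induct)
          case empty
          then show ?case
            using tideal_zero[OF J] by simp
        next
          case (insert j V)
          \<comment> \<open>\<open>b\<close> splits as \<open>b * r + b * x_j^N * y_j^N\<close>. The
            first summand is torsion at \<open>j\<close> too and falls under the outer induction
            with \<open>W - {j}\<close>; in the second, \<open>b * x_j^N\<close> is killed by the
            variables in \<open>V\<close> alone.\<close>
          define r where "r = 1 - xpow {j} N * (ypow {j} N :: ('n, 'k) jac)"
          have "b * r \<in> I" "b * r \<in> tors (- W)" "b * r \<in> xtors {j}"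
            using insert.prems tideal_mult_right[OF I] tideal_mult_right[OF tors_tideal]
              tideal_mult_left[OF xtors_tideal one_minus_in_xtors] by (auto simp: r_def)
          then have "b * r \<in> I \<inter> tors (- (W - {j}))"
            by (auto simp: tors_def)
          moreover have "card (W - {j}) < card W"
            using insert.prems(1) by (intro card_Diff1_less) auto
          ultimately have "b * r \<in> J"
            using less by blast
          moreover have "b * xpow {j} N \<in> J"
          proof (rule insert.IH)
            show "b * xpow {j} N * xpow V N = 0"
              using insert.prems(4) by (simp add: mult.assoc xpow_insert[OF insert.hyps(2)])
          qed (use insert.prems in \<open>auto intro: tideal_mult_right[OF I] tideal_mult_right[OF tors_tideal]\<close>)
          then have "b * xpow {j} N * ypow {j} N \<in> J"
            by (rule tideal_mult_right[OF J])
          ultimately have "b * r + b * xpow {j} N * ypow {j} N \<in> J"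
            by (rule tideal_add[OF J])
          then show ?case
            by (simp add: r_def right_diff_distrib mult.assoc)
        qed
        ultimately show "a \<in> J"
          using a by blast
      qed
    qed
  qed
  from this[of UNIV] show ?thesis
    by (auto simp: tors_def)
qed

section \<open>Transfer to the coefficient functions\<close>

definition coeffs :: "('n, 'k::field) jac \<Rightarrow> 'n mon \<Rightarrow> 'k" where
  "coeffs a = (\<lambda>m. lookup a (Mon m))"

definition of_fun :: "('n mon \<Rightarrow> 'k::field) \<Rightarrow> ('n, 'k) jac" where
  "of_fun f = Abs_poly_mapping (\<lambda>k. f (exps k))"

lemma coeffs_of_fun:
  assumes "f \<in> Jac"
  shows "coeffs (of_fun f) = f"
proof -
  have "{k. f (exps k) \<noteq> 0} = Mon ` {m. f m \<noteq> 0}"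
    by (auto simp: image_iff) (metis jmon.collapse)
  then have "finite {k. f (exps k) \<noteq> 0}"
    using assms by (simp add: Jac_def fin_supp_def)
  then show ?thesis
    by (simp add: coeffs_def of_fun_def)
qed

lemma coeffs_inject: "coeffs a = coeffs b \<longleftrightarrow> a = b"
proof
  assume *: "coeffs a = coeffs b"
  show "a = b"
  proof (rule poly_mapping_eqI)
    fix k show "lookup a k = lookup b k"
      using fun_cong[OF *, of "exps k"] by (simp add: coeffs_def)
  qed
qed simp

lemma coeffs_in_Jac: "coeffs a \<in> Jac"
proof -
  have "{m. lookup a (Mon m) \<noteq> 0} = Mon -` keys a"
    by (auto simp: in_keys_iff)
  then show ?thesis
    by (simp add: Jac_def fin_supp_def coeffs_def finite_vimageI inj_def)
qed

lemma of_fun_coeffs: "of_fun (coeffs a) = a"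
  by (simp add: coeffs_of_fun[OF coeffs_in_Jac] coeffs_inject[symmetric])

lemma range_coeffs: "range coeffs = Jac"
  using coeffs_in_Jac coeffs_of_fun by (metis image_eqI subsetI subset_antisym image_subset_iff UNIV_I)

lemma coeffs_zero: "coeffs 0 = (\<lambda>_. 0)"
  by (simp add: coeffs_def)

lemma coeffs_add: "coeffs (a + b) = (\<lambda>m. coeffs a m + coeffs b m)"
  by (simp add: coeffs_def lookup_add)

lemma coeffs_minus: "coeffs (a - b) = (\<lambda>m. coeffs a m - coeffs b m)"
  by (simp add: coeffs_def lookup_minus)

lemma coeffs_scalar: "coeffs (Poly_Mapping.single 0 k * a) = (\<lambda>m. k * coeffs a m)"
proof (induction a rule: poly_mapping_add_induct)
  case (single l v)
  then show ?case
    by (auto simp: coeffs_def mult_single lookup_single when_def)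
qed (simp_all add: coeffs_zero coeffs_add distrib_left)

lemma coeffs_mult: "coeffs (a * b) = jmul (coeffs a) (coeffs b)"
proof
  fix m
  have "a * b = (\<Sum>k\<in>keys a. Poly_Mapping.single k (lookup a k)) * (\<Sum>l\<in>keys b. Poly_Mapping.single l (lookup b l))"
    by (simp only: poly_mapping_expand)
  also have "\<dots> = (\<Sum>(k, l)\<in>keys a \<times> keys b. Poly_Mapping.single (k + l) (lookup a k * lookup b l))"
    by (simp only: sum_product sum.cartesian_product mult_single)
  finally have "coeffs (a * b) m = (\<Sum>(k, l)\<in>keys a \<times> keys b. if k + l = Mon m then lookup a k * lookup b l else 0)"
    by (simp add: coeffs_def lookup_sum lookup_single when_def case_prod_unfold)
  also have "\<dots> = (\<Sum>(k, l)\<in>{x \<in> keys a \<times> keys b. fst x + snd x = Mon m}. lookup a k * lookup b l)"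
    by (simp add: sum.inter_filter case_prod_unfold)
  also have "\<dots> = jmul (coeffs a) (coeffs b) m"
    unfolding jmul_def
    by (rule sum.reindex_bij_witness[where i = "map_prod Mon Mon" and j = "map_prod exps exps"])
      (auto simp: coeffs_def in_keys_iff plus_jmon_def)
  finally show "coeffs (a * b) m = jmul (coeffs a) (coeffs b) m" .
qed

lemma tideal_imp_jideal:
  assumes "tideal I"
  shows "jideal (coeffs ` I)"
  unfolding jideal_def
proof (intro conjI ballI)
  show "(\<lambda>_. 0) \<in> coeffs ` I"
    unfolding coeffs_zero[symmetric] using tideal_zero[OF assms] by (rule imageI)
  show "coeffs ` I \<subseteq> Jac"
    using coeffs_in_Jac by blast
  show "(\<lambda>m. a m + b m) \<in> coeffs ` I" if "a \<in> coeffs ` I" "b \<in> coeffs ` I" for a b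
    using that tideal_add[OF assms] by (auto simp: coeffs_add[symmetric])
  fix a b :: "'a mon \<Rightarrow> 'b" assume a: "a \<in> Jac" and "b \<in> coeffs ` I"
  then obtain b' where b: "b = coeffs b'" "b' \<in> I"
    by blast
  show "jmul a b \<in> coeffs ` I" "jmul b a \<in> coeffs ` I"
    using coeffs_mult[of "of_fun a" b'] coeffs_mult[of b' "of_fun a"] coeffs_of_fun[OF a] b
      tideal_mult_left[OF assms b(2)] tideal_mult_right[OF assms b(2)] by (metis imageI)+
qed

lemma jideal_imp_tideal:
  assumes "jideal J"
  shows "tideal (coeffs -` J)"
  using assms unfolding jideal_def
  by (intro tidealI) (auto simp: coeffs_zero coeffs_add coeffs_mult coeffs_in_Jac)

lemma jideal_image_vimage: "jideal J \<Longrightarrow> coeffs ` (coeffs -` J) = J"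
  unfolding image_vimage_eq range_coeffs by (auto simp: jideal_def)

lemma jideal_gen_minimal: "jideal L \<Longrightarrow> X \<subseteq> L \<Longrightarrow> jideal_gen X \<subseteq> L"
  by (auto simp: jideal_gen_def)

lemma jideal_gen_superset: "X \<subseteq> jideal_gen X"
  by (auto simp: jideal_gen_def)

text \<open>The hypothesis ensures that some ideal contains \<open>X\<close>; the intersection of
  the empty family would be the whole function type.\<close>

lemma jideal_jideal_gen:
  assumes "X \<subseteq> Jac"
  shows "jideal (jideal_gen X :: ('n mon \<Rightarrow> 'k::field) set)"
proof -
  have "jideal (coeffs ` UNIV :: ('n mon \<Rightarrow> 'k) set)"
    by (rule tideal_imp_jideal) (simp add: tideal_def)
  then have "jideal_gen X \<subseteq> Jac"
    using assms by (intro jideal_gen_minimal) (simp_all add: range_coeffs)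
  then show ?thesis
    unfolding jideal_def[of "jideal_gen X"] by (simp add: jideal_gen_def) (simp add: jideal_def)
qed

lemma idempotent_ideals_imp_idempotent:
  assumes "I \<in> idempotent_ideals"
  shows "idempotent (coeffs -` I)"
  unfolding idempotent_def
proof (intro conjI allI impI)
  have I: "jideal I" "jideal_prod I I = I"
    using assms by (auto simp: idempotent_ideals_def)
  show "tideal (coeffs -` I)"
    by (rule jideal_imp_tideal[OF I(1)])
  fix L :: "('a, 'b) jac set"
  assume L: "tideal L" "\<forall>a\<in>coeffs -` I. \<forall>b\<in>coeffs -` I. a * b \<in> L"
  have "jmul a b \<in> coeffs ` L" if "a \<in> I" "b \<in> I" for a b
  proof -
    have "a \<in> Jac" "b \<in> Jac"
      using that I(1) by (auto simp: jideal_def)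
    then have "coeffs (of_fun a) = a" "coeffs (of_fun b) = b"
      by (simp_all add: coeffs_of_fun)
    moreover from this have "of_fun a * of_fun b \<in> L"
      using L(2) that by simp
    ultimately show ?thesis
      using coeffs_mult[of "of_fun a" "of_fun b"] by (metis imageI)
  qed
  then have "jideal_prod I I \<subseteq> coeffs ` L"
    unfolding jideal_prod_def by (intro jideal_gen_minimal tideal_imp_jideal L(1)) auto
  then show "coeffs -` I \<subseteq> L"
    using I(2) by (auto simp: coeffs_inject)
qed

section \<open>Linear spans and elementary tensors\<close>

lemma ksubspace_kspan: "ksubspace (kspan X)"
  unfolding ksubspace_def[of "kspan X"] by (simp add: kspan_def) (simp add: ksubspace_def)

lemma kspan_superset: "x \<in> X \<Longrightarrow> x \<in> kspan X"
  by (auto simp: kspan_def)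

lemma kspan_minimal: "ksubspace V \<Longrightarrow> X \<subseteq> V \<Longrightarrow> kspan X \<subseteq> V"
  by (auto simp: kspan_def)

lemma ksubspace_zero: "ksubspace V \<Longrightarrow> (\<lambda>_. 0) \<in> V"
  and ksubspace_add: "ksubspace V \<Longrightarrow> f \<in> V \<Longrightarrow> g \<in> V \<Longrightarrow> (\<lambda>m. f m + g m) \<in> V"
  and ksubspace_scale: "ksubspace V \<Longrightarrow> f \<in> V \<Longrightarrow> (\<lambda>m. c * f m) \<in> V"
  by (simp_all add: ksubspace_def)

lemma ksubspace_coeffs_tideal:
  assumes "tideal I"
  shows "ksubspace (coeffs ` I)"
  unfolding ksubspace_def
proof (intro conjI ballI allI)
  show "(\<lambda>_. 0) \<in> coeffs ` I"
    unfolding coeffs_zero[symmetric] using tideal_zero[OF assms] by (rule imageI)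
  show "(\<lambda>m. a m + b m) \<in> coeffs ` I" if "a \<in> coeffs ` I" "b \<in> coeffs ` I" for a b
    using that tideal_add[OF assms] by (auto simp: coeffs_add[symmetric])
  show "(\<lambda>m. c * a m) \<in> coeffs ` I" if "a \<in> coeffs ` I" for a c
    using that tideal_mult_left[OF assms] by (auto simp: coeffs_scalar[symmetric])
qed

definition site :: "'n \<Rightarrow> nat \<times> nat \<Rightarrow> 'n mon" where
  "site i p = (\<lambda>t. if t = i then p else (0, 0))"

lemma jmono_site: "jmono (site i (k, l)) = xpow {i} k * ypow {i} l"
  by (auto simp: xpow_def ypow_def jmono_mult site_def mmul_def bmul_def intro!: arg_cong[of _ _ jmono])

lemma jmono_site_mult: "jmono (site i p) * jmono (site i q) = jmono (site i (bmul p q))"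
  by (auto simp: jmono_mult site_def mmul_def intro!: arg_cong[of _ _ jmono])

text \<open>No cancellation occurs, because \<open>c\<close> has trivial component at
  \<open>i\<close>: multiplication merely writes \<open>p\<close> into that coordinate.\<close>

lemma coeffs_mult_site:
  assumes "trivial_on {i} c"
  shows "coeffs (c * jmono (site i p)) = (\<lambda>m. if m i = p then coeffs c (m(i := (0, 0))) else 0)"
proof
  fix m
  have "c * jmono (site i p) = (\<Sum>k\<in>keys c. Poly_Mapping.single k (lookup c k)) * Poly_Mapping.single (Mon (site i p)) 1"
    by (simp only: poly_mapping_expand jmono_def)
  then have "coeffs (c * jmono (site i p)) m = (\<Sum>k\<in>keys c. if k + Mon (site i p) = Mon m then lookup c k else 0)"
    by (simp add: coeffs_def sum_distrib_right mult_single lookup_sum lookup_single when_def)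
  also have "\<dots> = (\<Sum>k\<in>keys c. if k = Mon (m(i := (0, 0))) then (if m i = p then lookup c k else 0) else 0)"
  proof (rule sum.cong[OF refl])
    fix k assume "k \<in> keys c"
    then have k: "exps k i = (0, 0)"
      using assms by (simp add: trivial_on_def)
    have "k + Mon (site i p) = Mon m \<longleftrightarrow> (\<forall>t. bmul (exps k t) (site i p t) = m t)"
      by (simp add: plus_jmon_def mmul_def fun_eq_iff)
    also have "\<dots> \<longleftrightarrow> (\<forall>t. if t = i then p = m i else exps k t = m t)"
      using k by (auto simp: site_def)
    also have "\<dots> \<longleftrightarrow> k = Mon (m(i := (0, 0))) \<and> m i = p"
      using k by (cases k) (auto simp: fun_eq_iff)
    finally show "(if k + Mon (site i p) = Mon m then lookup c k else 0) =
        (if k = Mon (m(i := (0, 0))) then (if m i = p then lookup c k else 0) else 0)"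
      by simp
  qed
  also have "\<dots> = (if m i = p then coeffs c (m(i := (0, 0))) else 0)"
    by (simp add: coeffs_def in_keys_iff)
  finally show "coeffs (c * jmono (site i p)) m = (if m i = p then coeffs c (m(i := (0, 0))) else 0)" .
qed

lemma tensor_upd: "tensor (a(i := s)) m = s (m i) * (\<Prod>t\<in>UNIV - {i}. a t (m t))"
proof -
  have "tensor (a(i := s)) m = (a(i := s)) i (m i) * (\<Prod>t\<in>UNIV - {i}. (a(i := s)) t (m t))"
    unfolding tensor_def by (rule prod.remove) auto
  also have "(\<Prod>t\<in>UNIV - {i}. (a(i := s)) t (m t)) = (\<Prod>t\<in>UNIV - {i}. a t (m t))"
    by (rule prod.cong) auto
  finally show ?thesis
    by (simp only: fun_upd_same)
qed

lemma tensor_in_Jac: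
  assumes "\<And>t. fin_supp (a t)"
  shows "tensor a \<in> Jac"
proof -
  have "{m. tensor a m \<noteq> 0} = (\<Pi>\<^sub>E t\<in>UNIV. {p. a t p \<noteq> 0})"
    by (auto simp: tensor_def PiE_def Pi_def)
  then show ?thesis
    using assms by (simp add: Jac_def fin_supp_def finite_PiE)
qed

lemma fin_supp_mono1: "fin_supp (mono1 p)"
  by (simp add: fin_supp_def mono1_def)

lemma fin_supp_F1:
  assumes "s \<in> F1"
  shows "fin_supp s"
proof -
  have "ksubspace {s :: nat \<times> nat \<Rightarrow> 'a. fin_supp s}"
    unfolding ksubspace_def fin_supp_def
  proof (intro conjI ballI allI)
    fix f g :: "nat \<times> nat \<Rightarrow> 'a" and c
    assume f: "f \<in> {s. finite {m. s m \<noteq> 0}}"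
    have "finite {m. c * f m \<noteq> 0}"
      by (rule finite_subset[of _ "{m. f m \<noteq> 0}"]) (use f in auto)
    then show "(\<lambda>m. c * f m) \<in> {s. finite {m. s m \<noteq> 0}}"
      by simp
    assume g: "g \<in> {s. finite {m. s m \<noteq> 0}}"
    have "finite {m. f m + g m \<noteq> 0}"
      by (rule finite_subset[of _ "{m. f m \<noteq> 0} \<union> {m. g m \<noteq> 0}"]) (use f g in auto)
    then show "(\<lambda>m. f m + g m) \<in> {s. finite {m. s m \<noteq> 0}}"
      by simp
  qed simp
  then have "F1 \<subseteq> {s :: nat \<times> nat \<Rightarrow> 'a. fin_supp s}"
    unfolding F1_def
  proof (rule kspan_minimal, clarify)
    fix k l
    have "{q. mono1 (k, l) q - mono1 (k + 1, l + 1) q \<noteq> (0 :: 'a)} \<subseteq> {(k, l), (k + 1, l + 1)}"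
      by (auto simp: mono1_def split: if_splits)
    then show "fin_supp (\<lambda>q. mono1 (k, l) q - mono1 (k + 1, l + 1) q :: 'a)"
      unfolding fin_supp_def by (rule finite_subset) simp
  qed
  then show ?thesis
    using assms by blast
qed

lemma F1_mono1_diff: "(\<lambda>q. mono1 (k, l) q - mono1 (k + r, l + r) q) \<in> F1"
proof (induction r)
  case 0
  then show ?case
    using ksubspace_zero[OF ksubspace_kspan] by (simp add: F1_def)
next
  case (Suc r)
  have "(\<lambda>q. mono1 (k + r, l + r) q - mono1 (k + r + 1, l + r + 1) q) \<in> F1"
    unfolding F1_def by (rule kspan_superset) blast
  from ksubspace_add[OF ksubspace_kspan Suc[unfolded F1_def] this[unfolded F1_def]] show ?case
    by (simp add: F1_def)
qed

text \<open>Turns replacing one tensor factor into right multiplication in the algebra, so that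
  torsion statements apply to tensors.\<close>

lemma tensor_mono1_eq:
  fixes a :: "'n::finite \<Rightarrow> nat \<times> nat \<Rightarrow> 'k::field"
  assumes "\<And>t. t \<noteq> i \<Longrightarrow> fin_supp (a t)"
  shows "tensor (a(i := mono1 p)) = coeffs (of_fun (tensor (a(i := mono1 (0, 0)))) * jmono (site i p))"
proof -
  let ?c = "of_fun (tensor (a(i := mono1 (0, 0))))"
  have c: "coeffs ?c = tensor (a(i := mono1 (0, 0)))"
    using assms by (intro coeffs_of_fun tensor_in_Jac) (simp add: fin_supp_mono1)
  have "trivial_on {i} ?c"
    unfolding trivial_on_def
  proof (intro ballI)
    fix k j assume "k \<in> keys ?c" "j \<in> {i}"
    then have "coeffs ?c (exps k) \<noteq> 0"
      by (simp add: coeffs_def in_keys_iff)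
    then show "exps k j = (0, 0)"
      using \<open>j \<in> {i}\<close> unfolding c tensor_upd by (auto simp: mono1_def split: if_splits)
  qed
  then have *: "coeffs (?c * jmono (site i p)) =
      (\<lambda>m. if m i = p then tensor (a(i := mono1 (0, 0))) (m(i := (0, 0))) else 0)"
    by (simp only: coeffs_mult_site c)
  show ?thesis
    unfolding * by (auto simp: tensor_upd mono1_def fun_eq_iff intro!: prod.cong)
qed

text \<open>The tensor is linear in its factor at \<open>i\<close>, so the generators of
  \<open>F1\<close> suffice; the generator for \<open>k\<close> and \<open>l\<close> is the matrix
  unit \<open>E_kl\<close>, a multiple of \<open>proj i\<close>.\<close>

lemma tensor_in_xtors:
  fixes a :: "'n::finite \<Rightarrow> nat \<times> nat \<Rightarrow> 'k::field"
  assumes "a i \<in> F1" "\<And>t. t \<noteq> i \<Longrightarrow> fin_supp (a t)"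
  shows "tensor a \<in> coeffs ` xtors {i}"
proof -
  define V where "V = {s. tensor (a(i := s)) \<in> coeffs ` xtors {i}}"
  note X = ksubspace_coeffs_tideal[OF xtors_tideal, of "{i}", where ?'b = 'k]
  have "ksubspace V"
    unfolding ksubspace_def
  proof (intro conjI ballI allI)
    show "(\<lambda>_. 0) \<in> V"
      using ksubspace_zero[OF X] by (simp add: V_def tensor_upd[abs_def])
    show "(\<lambda>m. f m + g m) \<in> V" if "f \<in> V" "g \<in> V" for f g
      using ksubspace_add[OF X] that by (simp add: V_def tensor_upd[abs_def] distrib_right)
    show "(\<lambda>m. c * f m) \<in> V" if "f \<in> V" for f c
      using ksubspace_scale[OF X] that by (simp add: V_def tensor_upd[abs_def] mult.assoc)
  qed
  moreover have "(\<lambda>q. mono1 (k, l) q - mono1 (k + 1, l + 1) q) \<in> V" for k l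
  proof -
    let ?c = "of_fun (tensor (a(i := mono1 (0, 0))))"
    have eq: "tensor (a(i := mono1 p)) = coeffs (?c * jmono (site i p))" for p
      using assms(2) by (rule tensor_mono1_eq)
    have "tensor (a(i := \<lambda>q. mono1 (k, l) q - mono1 (k + 1, l + 1) q)) =
        (\<lambda>m. tensor (a(i := mono1 (k, l))) m - tensor (a(i := mono1 (k + 1, l + 1))) m)"
      by (simp add: tensor_upd[abs_def] left_diff_distrib)
    also have "\<dots> = coeffs (?c * jmono (site i (k, l)) - ?c * jmono (site i (k + 1, l + 1)))"
      by (simp only: coeffs_minus eq[of "(k, l)"] eq[of "(k + 1, l + 1)"])
    also have "?c * jmono (site i (k, l)) - ?c * jmono (site i (k + 1, l + 1)) = ?c * xpow {i} k * proj i * ypow {i} l"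
      unfolding jmono_site add.commute[of l 1] xpow_add ypow_add
      by (simp add: proj_def right_diff_distrib left_diff_distrib mult.assoc)
    finally have "tensor (a(i := \<lambda>q. mono1 (k, l) q - mono1 (k + 1, l + 1) q)) = coeffs (?c * xpow {i} k * proj i * ypow {i} l)" .
    moreover have "(proj i :: ('n, 'k) jac) \<in> xtors {i}"
      unfolding xtors_def by (intro CollectI exI[of _ "Suc 0"] proj_xpow)
    then have "?c * xpow {i} k * proj i * ypow {i} l \<in> xtors {i}"
      by (intro tideal_mult_right[OF xtors_tideal] tideal_mult_left[OF xtors_tideal])
    ultimately show ?thesis
      by (simp add: V_def)
  qed
  ultimately have "F1 \<subseteq> V"
    unfolding F1_def by (intro kspan_minimal) auto
  then show ?thesis
    using assms(1) by (auto simp: V_def)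
qed

text \<open>Factors outside \<open>Z\<close> are kept as single monomials, so that when a new index
  \<open>j\<close> is added its factor is one \<open>x^k y^l\<close>, whose product with
  \<open>1 - x^N y^N\<close> is explicit.\<close>

lemma coeffs_tors_subset_kspan:
  assumes "finite Z" "(a :: ('n::finite, 'k::field) jac) \<in> tors Z"
  shows "coeffs a \<in> kspan {tensor t | t. \<forall>i. t i \<in> (if i \<in> Z then F1 else range mono1)}"
  using assms
proof (induction Z arbitrary: a rule: finite_induct)
  case empty
  let ?X = "{tensor t | t :: 'n \<Rightarrow> nat \<times> nat \<Rightarrow> 'k. \<forall>i. t i \<in> (if i \<in> {} then F1 else range mono1)}"
  have "coeffs a \<in> kspan ?X"
  proof (induction a rule: jac_induct)
    case (jmono m)
    have "coeffs (jmono m) = (tensor (\<lambda>i. mono1 (m i)) :: 'n mon \<Rightarrow> 'k)"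
    proof
      fix m'
      have "(\<Prod>i\<in>UNIV. if m' i = m i then 1 else 0 :: 'k) = (if m' = m then 1 else 0)"
        by (auto simp: fun_eq_iff)
      then show "coeffs (jmono m) m' = (tensor (\<lambda>i. mono1 (m i)) m' :: 'k)"
        by (auto simp: coeffs_def jmono_def lookup_single tensor_def mono1_def when_def)
    qed
    moreover have "tensor (\<lambda>i. mono1 (m i)) \<in> ?X"
      by auto
    ultimately show ?case
      by (simp only: kspan_superset)
  qed (simp_all add: coeffs_scalar coeffs_add ksubspace_scale ksubspace_add ksubspace_kspan)
  then show ?case .
next
  case (insert j Z)
  let ?X = "\<lambda>Z. {tensor t | t :: 'n \<Rightarrow> nat \<times> nat \<Rightarrow> 'k. \<forall>i. t i \<in> (if i \<in> Z then F1 else range mono1)}"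
  obtain N where N: "a * xpow {j} N = 0"
    using insert.prems by (auto simp: tors_def xtors_def)
  define r where "r = 1 - xpow {j} N * (ypow {j} N :: ('n, 'k) jac)"
  have a: "a = a * r"
    using N by (simp add: r_def right_diff_distrib mult.assoc[symmetric])
  have fin: "fin_supp (t i)" if "\<forall>i. t i \<in> (if i \<in> Z then F1 else range (mono1 :: _ \<Rightarrow> _ \<Rightarrow> 'k))" for t :: "'n \<Rightarrow> nat \<times> nat \<Rightarrow> 'k" and i
    using spec[OF that, of i] fin_supp_F1 fin_supp_mono1 by (auto split: if_splits)
  define S where "S = kspan (?X (insert j Z))"
  have S: "ksubspace S"
    unfolding S_def by (rule ksubspace_kspan)
  \<comment> \<open>Since \<open>a = a * r\<close>, it is enough that right multiplication by
    \<open>r\<close> carries the span for \<open>Z\<close> into the span for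
    \<open>insert j Z\<close>; by linearity this is checked on tensors.\<close>
  define V where "V = coeffs ` {b. coeffs (b * r) \<in> S}"
  have "ksubspace V"
    unfolding ksubspace_def
  proof (intro conjI ballI allI)
    show "(\<lambda>_. 0) \<in> V"
      unfolding V_def using ksubspace_zero[OF S]
      by (intro image_eqI[of _ _ 0]) (simp_all add: coeffs_zero)
    show "(\<lambda>m. f m + g m) \<in> V" if "f \<in> V" "g \<in> V" for f g
      using that ksubspace_add[OF S] unfolding V_def
      by (auto simp: coeffs_add[symmetric] distrib_right intro!: imageI) (simp add: coeffs_add)
    show "(\<lambda>m. c * f m) \<in> V" if "f \<in> V" for f c
      using that ksubspace_scale[OF S] unfolding V_def
      by (auto simp: coeffs_scalar[symmetric] mult.assoc intro!: imageI) (simp add: coeffs_scalar)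
  qed
  moreover have "tensor t \<in> V" if t: "\<forall>i. t i \<in> (if i \<in> Z then F1 else range mono1)" for t
  proof -
    obtain k l where kl: "t j = mono1 (k, l)"
      using spec[OF t, of j] insert.hyps(2) by auto
    let ?c = "of_fun (tensor (t(j := mono1 (0, 0))))"
    have eq: "tensor (t(j := mono1 p)) = coeffs (?c * jmono (site j p))" for p
      using fin[OF t] by (intro tensor_mono1_eq)
    \<comment> \<open>\<open>x^k y^l x^N y^N\<close> equals \<open>x^(k+d) y^(l+d)\<close>, so
      \<open>r\<close> turns the factor at \<open>j\<close> into a difference of two monomials on
      one diagonal, which telescopes inside \<open>F1\<close>.\<close>
    define d where "d = N - min l N"
    have "t = t(j := mono1 (k, l))"
      using kl by auto
    then have *: "tensor t = coeffs (?c * jmono (site j (k, l)))"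
      using eq[of "(k, l)"] by simp
    have r: "r = 1 - jmono (site j (N, N))"
      by (simp add: r_def jmono_site)
    have "?c * jmono (site j (k, l)) * r = ?c * jmono (site j (k, l)) - ?c * jmono (site j (bmul (k, l) (N, N)))"
      unfolding r by (simp add: right_diff_distrib mult.assoc jmono_site_mult)
    also have "bmul (k, l) (N, N) = (k + d, l + d)"
      by (auto simp: bmul_def d_def min_def)
    finally have "coeffs (?c * jmono (site j (k, l)) * r) =
        (\<lambda>m. tensor (t(j := mono1 (k, l))) m - tensor (t(j := mono1 (k + d, l + d))) m)"
      by (simp only: coeffs_minus eq[of "(k, l)"] eq[of "(k + d, l + d)"])
    also have "\<dots> = tensor (t(j := \<lambda>q. mono1 (k, l) q - mono1 (k + d, l + d) q))"
      by (simp add: tensor_upd[abs_def] left_diff_distrib)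
    also have "\<dots> \<in> ?X (insert j Z)"
    proof (intro CollectI exI[of _ "t(j := \<lambda>q. mono1 (k, l) q - mono1 (k + d, l + d) q)"] conjI refl allI)
      fix i
      show "(t(j := \<lambda>q. mono1 (k, l) q - mono1 (k + d, l + d) q)) i \<in> (if i \<in> insert j Z then F1 else range mono1)"
        using spec[OF t, of i] F1_mono1_diff by (cases "i = j") auto
    qed
    finally have "coeffs (?c * jmono (site j (k, l)) * r) \<in> S"
      unfolding S_def by (rule kspan_superset)
    then show ?thesis
      unfolding V_def * by (intro imageI CollectI)
  qed
  ultimately have "kspan (?X Z) \<subseteq> V"
    by (intro kspan_minimal) auto
  moreover have "coeffs a \<in> kspan (?X Z)"
    using insert.prems by (intro insert.IH) (simp add: tors_def)
  ultimately have "coeffs a \<in> V"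
    by blast
  then have "coeffs (a * r) \<in> S"
    by (auto simp: V_def coeffs_inject)
  then show ?case
    unfolding a[symmetric] S_def .
qed

theorem Ifun_eq_tors: "(Ifun f :: ('n::finite mon \<Rightarrow> 'k::field) set) = coeffs ` tors {i. \<not> f i}"
proof
  show "(Ifun f :: ('n mon \<Rightarrow> 'k) set) \<subseteq> coeffs ` tors {i. \<not> f i}"
    unfolding Ifun_def
  proof (rule kspan_minimal[OF ksubspace_coeffs_tideal[OF tors_tideal]], clarify)
    fix a :: "'n \<Rightarrow> nat \<times> nat \<Rightarrow> 'k" assume a: "\<forall>t. a t \<in> Ifac (f t)"
    have fin: "fin_supp (a t)" for t
      using spec[OF a, of t] fin_supp_F1 by (auto simp: Ifac_def S1_def split: if_splits)
    have "of_fun (tensor a) \<in> xtors {i}" if "\<not> f i" for i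
    proof -
      have "tensor a \<in> coeffs ` xtors {i}"
        using spec[OF a, of i] that fin by (intro tensor_in_xtors) (simp_all add: Ifac_def)
      then show ?thesis
        by (auto simp: of_fun_coeffs)
    qed
    then have "of_fun (tensor a) \<in> tors {i. \<not> f i}"
      by (simp add: tors_def)
    then show "tensor a \<in> coeffs ` tors {i. \<not> f i}"
      using coeffs_of_fun[OF tensor_in_Jac[of a]] fin by (metis imageI)
  qed
  have "kspan {tensor t | t. \<forall>i. t i \<in> (if i \<in> {i. \<not> f i} then F1 else range mono1)} \<subseteq> (Ifun f :: ('n mon \<Rightarrow> 'k) set)"
    unfolding Ifun_def
  proof (rule kspan_minimal[OF ksubspace_kspan], clarify)
    fix t :: "'n \<Rightarrow> nat \<times> nat \<Rightarrow> 'k"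
    assume t: "\<forall>i. t i \<in> (if i \<in> {i. \<not> f i} then F1 else range mono1)"
    have "t i \<in> Ifac (f i)" for i
      using spec[OF t, of i] fin_supp_mono1 by (auto simp: Ifac_def S1_def split: if_splits)
    then show "tensor t \<in> kspan {tensor a | a. \<forall>t. a t \<in> Ifac (f t)}"
      by (intro kspan_superset) auto
  qed
  then show "coeffs ` tors {i. \<not> f i} \<subseteq> (Ifun f :: ('n mon \<Rightarrow> 'k) set)"
    using coeffs_tors_subset_kspan[of "{i. \<not> f i}", where 'k = 'k] by fastforce
qed

section \<open>The ideals of antichains and the bijection\<close>

lemma Ifun_subset_Jac: "Ifun f \<subseteq> Jac"
  unfolding Ifun_eq_tors using coeffs_in_Jac by blast

lemma Ifun_mono:
  assumes "f \<le> g"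
  shows "Ifun f \<subseteq> Ifun g"
  unfolding Ifun_eq_tors using assms by (intro image_mono tors_antimono) (auto simp: le_fun_def)

lemma jideal_IC: "jideal (IC C)"
  unfolding IC_def using Ifun_subset_Jac by (intro jideal_jideal_gen) blast

lemma Ifun_subset_IC: "f \<in> C \<Longrightarrow> Ifun f \<subseteq> IC C"
  unfolding IC_def using jideal_gen_superset by blast

lemma IC_minimal: "jideal L \<Longrightarrow> (\<And>f. f \<in> C \<Longrightarrow> Ifun f \<subseteq> L) \<Longrightarrow> IC C \<subseteq> L"
  unfolding IC_def by (intro jideal_gen_minimal) auto

lemma IC_idempotent: "(IC C :: ('n::finite mon \<Rightarrow> 'k::field) set) \<in> idempotent_ideals"
proof -
  let ?I = "IC C :: ('n mon \<Rightarrow> 'k) set"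
  have sub: "{jmul a b | a b. a \<in> ?I \<and> b \<in> ?I} \<subseteq> ?I"
    using jideal_IC[of C, where 'b = 'k] by (auto simp: jideal_def)
  then have "{jmul a b | a b. a \<in> ?I \<and> b \<in> ?I} \<subseteq> Jac"
    using jideal_IC[of C, where 'b = 'k] by (auto simp: jideal_def)
  then have P: "jideal (jideal_prod ?I ?I)"
    unfolding jideal_prod_def by (rule jideal_jideal_gen)
  have "jideal_prod ?I ?I \<subseteq> ?I"
    unfolding jideal_prod_def by (rule jideal_gen_minimal[OF jideal_IC sub])
  moreover have "?I \<subseteq> jideal_prod ?I ?I"
  proof (rule IC_minimal[OF P])
    fix f assume f: "f \<in> C"
    show "Ifun f \<subseteq> jideal_prod ?I ?I"
    proof
      fix x :: "'n mon \<Rightarrow> 'k" assume x: "x \<in> Ifun f"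
      then obtain a where a: "x = coeffs a" "a \<in> tors {i. \<not> f i}"
        by (auto simp: Ifun_eq_tors)
      obtain u where u: "u \<in> tors {i. \<not> f i}" "a * u = a"
        using tors_unit_right[OF a(2)] by blast
      \<comment> \<open>The local unit exhibits \<open>x\<close> as a product of two elements of the
        ideal.\<close>
      have "x = jmul x (coeffs u)"
        using u(2) a(1) coeffs_mult[of a u] by simp
      moreover have "coeffs u \<in> ?I" "x \<in> ?I"
        using Ifun_subset_IC[OF f] x u(1) Ifun_eq_tors[of f] by auto
      ultimately have "x \<in> {jmul a b | a b. a \<in> ?I \<and> b \<in> ?I}"
        by (intro CollectI exI[of _ x] exI[of _ "coeffs u"]) simp
      then show "x \<in> jideal_prod ?I ?I"
        unfolding jideal_prod_def by (rule subsetD[OF jideal_gen_superset])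
    qed
  qed
  ultimately show ?thesis
    using jideal_IC by (auto simp: idempotent_ideals_def)
qed

text \<open>With \<open>W\<close> the support of \<open>f\<close>, an ideal \<open>I_g\<close> with
  \<open>g\<close> not above \<open>f\<close> has a torsion index in \<open>W\<close> and so lies in
  \<open>xtors W\<close>. The idempotent \<open>e\<close> for the complement of \<open>W\<close>
  lies in \<open>I_f\<close> but is not torsion over \<open>W\<close>: \<open>e x^N = 0\<close>
  would give \<open>e = y^N e x^N = 0\<close>.\<close>

lemma Ifun_subset_IC_imp_le:
  assumes "(Ifun f :: ('n::finite mon \<Rightarrow> 'k::field) set) \<subseteq> IC C"
  shows "\<exists>g\<in>C. f \<le> g"
proof (rule ccontr)
  assume neg: "\<not> ?thesis"
  define W where "W = {i. f i}"
  have "(IC C :: ('n mon \<Rightarrow> 'k) set) \<subseteq> coeffs ` xtors W"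
  proof (rule IC_minimal[OF tideal_imp_jideal[OF xtors_tideal]])
    fix g assume "g \<in> C"
    then obtain i where "f i" "\<not> g i"
      using neg by (auto simp: le_fun_def)
    then have "tors {i. \<not> g i} \<subseteq> xtors {i}" "xtors {i} \<subseteq> xtors W"
      using xtors_antimono[of "{i}" W] by (auto simp: tors_def W_def)
    then show "(Ifun g :: ('n mon \<Rightarrow> 'k) set) \<subseteq> coeffs ` xtors W"
      unfolding Ifun_eq_tors by blast
  qed
  moreover obtain e :: "('n, 'k) jac" where e: "corner (- W) e"
    using corner_exists by blast
  have "coeffs e \<in> Ifun f"
    using corner_in_tors[OF e] unfolding Ifun_eq_tors by (simp add: W_def Collect_neg_eq)
  ultimately have "e \<in> xtors W"
    using assms by (auto simp: coeffs_inject)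
  then obtain N where N: "e * xpow W N = 0"
    by (auto simp: xtors_def)
  have "ypow W N * (e * xpow W N) = e * ypow W N * xpow W N"
    using corner_ypow_commute[OF e, of W N] by (simp add: mult.assoc[symmetric])
  then have "e = ypow W N * (e * xpow W N)"
    by (simp add: mult.assoc)
  then have "e * 1 = 0"
    using N by simp
  moreover have "trivial_on (- W) (1 :: ('n, 'k) jac)"
    by (simp add: trivial_on_def zero_jmon_def)
  ultimately show False
    using corner_no_kernel[OF e] by fastforce
qed

lemma inj_on_IC: "inj_on (IC :: ('n::finite \<Rightarrow> bool) set \<Rightarrow> ('n mon \<Rightarrow> 'k::field) set) antichains_B"
proof (rule inj_onI)
  have sub: "C \<subseteq> D" if CD: "C \<in> antichains_B" "D \<in> antichains_B" "(IC C :: ('n mon \<Rightarrow> 'k) set) = IC D" for C D :: "('n \<Rightarrow> bool) set"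
  proof
    fix f assume f: "f \<in> C"
    obtain g where g: "g \<in> D" "f \<le> g"
      using Ifun_subset_IC_imp_le[of f D, where 'k = 'k] Ifun_subset_IC[OF f, where 'b = 'k] CD(3) by auto
    obtain h where h: "h \<in> C" "g \<le> h"
      using Ifun_subset_IC_imp_le[of g C, where 'k = 'k] Ifun_subset_IC[OF g(1), where 'b = 'k] CD(3) by auto
    have "f = h"
      using CD(1) f h(1) order_trans[OF g(2) h(2)] unfolding antichains_B_def by blast
    then show "f \<in> D"
      using g h by (metis order_antisym)
  qed
  fix C D :: "('n \<Rightarrow> bool) set"
  assume "C \<in> antichains_B" "D \<in> antichains_B" "(IC C :: ('n mon \<Rightarrow> 'k) set) = IC D"
  then show "C = D"
    using sub[of C D] sub[of D C] by auto
qed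

lemma idempotent_ideal_eq_IC:
  assumes "(I :: ('n::finite mon \<Rightarrow> 'k::field) set) \<in> idempotent_ideals"
  shows "\<exists>C\<in>antichains_B. I = IC C"
proof -
  have I: "jideal I"
    using assms by (simp add: idempotent_ideals_def)
  define D where "D = {f. Ifun f \<subseteq> I}"
  \<comment> \<open>Keeping only the maximal functions yields an antichain and loses nothing:
    \<open>D\<close> is finite, so each of its members lies below a maximal one, and
    \<open>Ifun\<close> is monotone.\<close>
  define C where "C = {f \<in> D. \<forall>g\<in>D. f \<le> g \<longrightarrow> f = g}"
  have "IC C \<subseteq> I"
    by (rule IC_minimal[OF I]) (auto simp: C_def D_def)
  moreover have "coeffs -` I \<subseteq> coeffs -` IC C"
  proof (rule idempotent_subset[OF idempotent_ideals_imp_idempotent[OF assms] jideal_imp_tideal[OF jideal_IC]])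
    fix Z :: "'n set" assume Z: "tors Z \<subseteq> coeffs -` I"
    have Ifun: "Ifun (\<lambda>i. i \<notin> Z) = (coeffs ` tors Z :: ('n mon \<Rightarrow> 'k) set)"
      unfolding Ifun_eq_tors by simp
    then have "(\<lambda>i. i \<notin> Z) \<in> D"
      using Z by (auto simp: D_def)
    then obtain g where g: "g \<in> D" "(\<lambda>i. i \<notin> Z) \<le> g" "\<forall>h\<in>D. g \<le> h \<longrightarrow> g = h"
      using finite_has_maximal2[of D "\<lambda>i. i \<notin> Z"] by auto
    then have "g \<in> C"
      by (simp add: C_def)
    then have "Ifun (\<lambda>i. i \<notin> Z) \<subseteq> (IC C :: ('n mon \<Rightarrow> 'k) set)"
      using Ifun_mono[OF g(2)] Ifun_subset_IC by blast
    then show "tors Z \<subseteq> coeffs -` (IC C :: ('n mon \<Rightarrow> 'k) set)"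
      unfolding Ifun by blast
  qed
  then have "I \<subseteq> IC C"
    unfolding image_subset_iff_subset_vimage[symmetric] jideal_image_vimage[OF I] .
  moreover have "C \<in> antichains_B"
    by (auto simp: C_def antichains_B_def)
  ultimately show ?thesis
    by blast
qed

lemma bij_betw_IC:
  "bij_betw (IC :: ('n::finite \<Rightarrow> bool) set \<Rightarrow> ('n mon \<Rightarrow> 'k::field) set) antichains_B idempotent_ideals"
  unfolding bij_betw_def using inj_on_IC IC_idempotent idempotent_ideal_eq_IC by blast

section \<open>Invariance under the involution\<close>

lemma eta_eta [simp]: "eta (eta a) = a"
  by (simp add: eta_def)

lemma eta_in_Jac:
  assumes "a \<in> Jac"
  shows "eta a \<in> Jac"
proof -
  have "{m. a (\<lambda>t. prod.swap (m t)) \<noteq> 0} = (\<lambda>m t. prod.swap (m t)) ` {m. a m \<noteq> 0}"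
    by (auto simp: image_iff intro!: exI[of _ "\<lambda>t. prod.swap (_ t)"])
  then show ?thesis
    using assms by (simp add: Jac_def fin_supp_def eta_def)
qed

lemma swap_bmul: "prod.swap (bmul p q) = bmul (prod.swap q) (prod.swap p)"
  by (auto simp: bmul_def min.commute add.commute)

lemma eta_jmul: "eta (jmul a b) = jmul (eta b) (eta a :: 'n mon \<Rightarrow> 'k::field)"
proof
  fix m :: "'n mon"
  let ?s = "\<lambda>m t. prod.swap (m t)"
  have "mmul p q = ?s m \<longleftrightarrow> mmul (?s q) (?s p) = m" for p q
    by (auto simp: mmul_def fun_eq_iff swap_bmul[symmetric]) (metis swap_swap)+
  then show "eta (jmul a b) m = jmul (eta b) (eta a) m"
    unfolding jmul_def eta_def
    by (intro sum.reindex_bij_witness[where i = "\<lambda>(p, q). (?s q, ?s p)" and j = "\<lambda>(p, q). (?s q, ?s p)"])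
      (auto simp: mult.commute)
qed

lemma eta_jideal:
  assumes "jideal L"
  shows "jideal (eta ` L)"
  unfolding jideal_def
proof (intro conjI ballI)
  show "eta ` L \<subseteq> Jac"
    using assms eta_in_Jac by (auto simp: jideal_def)
  have "eta (\<lambda>_. 0) \<in> eta ` L"
    using assms by (simp add: jideal_def)
  then show "(\<lambda>_. 0) \<in> eta ` L"
    by (simp add: eta_def)
  show "(\<lambda>m. a m + b m) \<in> eta ` L" if ab: "a \<in> eta ` L" "b \<in> eta ` L" for a b
  proof -
    obtain a' b' where "a = eta a'" "b = eta b'" "a' \<in> L" "b' \<in> L"
      using ab by blast
    then have "(\<lambda>m. a m + b m) = eta (\<lambda>m. a' m + b' m)" "(\<lambda>m. a' m + b' m) \<in> L"
      using assms by (auto simp: jideal_def eta_def)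
    then show ?thesis
      by blast
  qed
  fix a b :: "'a mon \<Rightarrow> 'b" assume a: "a \<in> Jac" and "b \<in> eta ` L"
  then obtain b' where b: "b = eta b'" "b' \<in> L"
    by blast
  have "jmul a b = eta (jmul b' (eta a))" "jmul b a = eta (jmul (eta a) b')"
    by (simp_all add: eta_jmul b(1))
  moreover have "jmul b' (eta a) \<in> L" "jmul (eta a) b' \<in> L"
    using assms b(2) eta_in_Jac[OF a] by (auto simp: jideal_def)
  ultimately show "jmul a b \<in> eta ` L" "jmul b a \<in> eta ` L"
    by auto
qed

lemma eta_ypow: "eta (coeffs (ypow W N)) = (coeffs (xpow W N) :: 'n mon \<Rightarrow> 'k::field)"
proof
  fix m :: "'n mon"
  have "(\<lambda>i. if i \<in> W then (0, N) else (0, 0)) = (\<lambda>t. prod.swap (m t)) \<longleftrightarrow> (\<lambda>i. if i \<in> W then (N, 0) else (0, 0)) = m"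
    by (auto simp: fun_eq_iff prod_eq_iff split: if_splits)
  then show "eta (coeffs (ypow W N)) m = coeffs (xpow W N) m"
    by (simp add: eta_def coeffs_def xpow_def ypow_def jmono_def lookup_single when_def)
qed

text \<open>The involution exchanges torsion under left powers of \<open>y_i\<close> with torsion
  under right powers of \<open>x_i\<close>, and \<open>xtors_imp_ytors\<close> supplies the former
  for each index separately.\<close>

lemma eta_Ifun: "eta ` (Ifun f :: ('n::finite mon \<Rightarrow> 'k::field) set) \<subseteq> Ifun f"
proof
  fix x :: "'n mon \<Rightarrow> 'k" assume "x \<in> eta ` Ifun f"
  then obtain a where a: "x = eta (coeffs a)" "a \<in> tors {i. \<not> f i}"
    by (auto simp: Ifun_eq_tors)
  define b where "b = of_fun x"
  have x: "coeffs b = x"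
    unfolding b_def a(1) by (intro coeffs_of_fun eta_in_Jac coeffs_in_Jac)
  have "b \<in> xtors {i}" if "\<not> f i" for i
  proof -
    have "a \<in> ytors {i}"
      using a(2) that by (intro xtors_imp_ytors) (simp add: tors_def)
    then obtain N where "ypow {i} N * a = 0"
      by (auto simp: ytors_def)
    then have "coeffs (b * xpow {i} N) = eta (coeffs 0)"
      unfolding coeffs_mult x a(1) eta_ypow[symmetric] eta_jmul[symmetric] by (simp add: coeffs_mult[symmetric])
    also have "\<dots> = coeffs 0"
      by (simp add: coeffs_zero eta_def)
    finally show ?thesis
      by (auto simp: coeffs_inject xtors_def)
  qed
  then have "b \<in> tors {i. \<not> f i}"
    by (simp add: tors_def)
  then show "x \<in> Ifun f"
    unfolding Ifun_eq_tors using x by blast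
qed

text \<open>The image of the ideal under \<open>eta\<close> is an ideal containing every generating
  \<open>I_f\<close>, which gives one inclusion; applying \<open>eta\<close> to it gives the
  other.\<close>

lemma eta_IC: "eta ` (IC C :: ('n::finite mon \<Rightarrow> 'k::field) set) = IC C"
proof -
  have sub: "(IC C :: ('n mon \<Rightarrow> 'k) set) \<subseteq> eta ` IC C"
  proof (rule IC_minimal[OF eta_jideal[OF jideal_IC]])
    fix f assume f: "f \<in> C"
    show "(Ifun f :: ('n mon \<Rightarrow> 'k) set) \<subseteq> eta ` IC C"
    proof
      fix a :: "'n mon \<Rightarrow> 'k" assume "a \<in> Ifun f"
      then have "eta a \<in> IC C"
        using eta_Ifun Ifun_subset_IC[OF f] by blast
      then show "a \<in> eta ` IC C"
        by (metis eta_eta imageI)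
    qed
  qed
  then have "eta ` IC C \<subseteq> eta ` eta ` (IC C :: ('n mon \<Rightarrow> 'k) set)"
    by (rule image_mono)
  then show ?thesis
    using sub by (simp add: image_image)
qed

section \<open>Counting antichains by Dedekind numbers\<close>

lemma card_antichains_B: "card (antichains_B :: ('n::finite \<Rightarrow> bool) set set) = dedekind (card (UNIV :: 'n set))"
proof -
  let ?n = "card (UNIV :: 'n set)"
  obtain h :: "'n \<Rightarrow> nat" where h: "bij_betw h UNIV {1..?n}"
    using finite_same_card_bij[of "UNIV :: 'n set" "{1..?n}"] by auto
  have inj: "inj h"
    using h by (simp add: bij_betw_def)
  \<comment> \<open>Sending a Boolean function to its support, relabelled by \<open>h\<close>, is an
    order isomorphism onto the power set, so taking images matches the antichains.\<close>
  define G where "G f = h ` {i. f i}" for f :: "'n \<Rightarrow> bool"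
  have G_le: "G f \<subseteq> G g \<longleftrightarrow> f \<le> g" for f g
    unfolding G_def inj_image_subset_iff[OF inj] by (auto simp: le_fun_def)
  have G_inj: "inj G"
    by (rule injI) (metis G_le order_antisym order_refl)
  have G_range: "range G = Pow {1..?n}"
  proof
    show "range G \<subseteq> Pow {1..?n}"
      using h by (auto simp: G_def bij_betw_def)
    show "Pow {1..?n} \<subseteq> range G"
    proof
      fix X assume "X \<in> Pow {1..?n}"
      then have "X \<subseteq> range h"
        using h by (simp add: bij_betw_def)
      then have "X = G (\<lambda>i. h i \<in> X)"
        by (auto simp: G_def)
      then show "X \<in> range G"
        by blast
    qed
  qed
  have "image G ` antichains_B = {A. A \<subseteq> Pow {1..?n} \<and> (\<forall>X\<in>A. \<forall>Y\<in>A. X \<subseteq> Y \<longrightarrow> X = Y)}" (is "?L = ?R")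
  proof
    show "?L \<subseteq> ?R"
    proof (rule image_subsetI, rule CollectI, intro conjI ballI impI)
      fix C :: "('n \<Rightarrow> bool) set" and X Y :: "nat set"
      assume C: "C \<in> antichains_B"
      show "G ` C \<subseteq> Pow {1..?n}"
        using G_range by blast
      assume "X \<in> G ` C" "Y \<in> G ` C" "X \<subseteq> Y"
      then obtain f g where "X = G f" "Y = G g" "f \<in> C" "g \<in> C" "f \<le> g"
        using G_le by blast
      then show "X = Y"
        using C unfolding antichains_B_def by blast
    qed
    show "?R \<subseteq> ?L"
    proof
      fix A assume A: "A \<in> ?R"
      then have "A = G ` (G -` A)"
        using G_range by auto
      moreover have "G -` A \<in> antichains_B"
        unfolding antichains_B_def
      proof (intro CollectI ballI impI)
        fix f g assume "f \<in> G -` A" "g \<in> G -` A" "f \<le> g"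
        then have "G f = G g"
          using A G_le[of f g] by blast
        then show "f = g"
          using injD[OF G_inj] by blast
      qed
      ultimately show "A \<in> ?L"
        by blast
    qed
  qed
  moreover have "inj_on (image G) antichains_B"
    using G_inj by (simp add: inj_on_def inj_image_eq_iff)
  ultimately show ?thesis
    unfolding dedekind_def by (metis card_image)
qed

theorem theorem7p1:
  shows "bij_betw (IC :: ('n::finite \<Rightarrow> bool) set \<Rightarrow> ('n mon \<Rightarrow> 'k::field) set)
            antichains_B idempotent_ideals
       \<and> finite (idempotent_ideals :: ('n mon \<Rightarrow> 'k) set set)
       \<and> card (idempotent_ideals :: ('n mon \<Rightarrow> 'k) set set) = dedekind (card (UNIV :: 'n set))
       \<and> (\<forall>I \<in> (idempotent_ideals :: ('n mon \<Rightarrow> 'k) set set). eta ` I = I)"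
proof (intro conjI ballI)
  show bij: "bij_betw (IC :: ('n \<Rightarrow> bool) set \<Rightarrow> ('n mon \<Rightarrow> 'k) set) antichains_B idempotent_ideals"
    by (rule bij_betw_IC)
  show "finite (idempotent_ideals :: ('n mon \<Rightarrow> 'k) set set)"
    using bij_betw_finite[OF bij] by simp
  show "card (idempotent_ideals :: ('n mon \<Rightarrow> 'k) set set) = dedekind (card (UNIV :: 'n set))"
    using bij_betw_same_card[OF bij] card_antichains_B[where 'n = 'n] by simp
  show "eta ` I = I" if "I \<in> idempotent_ideals" for I :: "('n mon \<Rightarrow> 'k) set"
    using idempotent_ideal_eq_IC[OF that] eta_IC by auto
qed

end
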